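(* Let $p\in(1,\infty)$, let $\ell:\mathbb{R}\to\mathbb{R}$ be a convex function, and suppose that $\rho:\mathcal{M}_p(\mathbb{R})\to\mathbb{R}$ is given by $\rho^G(X):=\inf_{s\in\mathbb{R}}\mathbb{E}^G[\ell(X-s)]$ (in particular $\rho$ is real-valued on $\mathcal{M}_p(\mathbb{R})$). Then there exists a constant $c=c_{\ell,p}>0$ such that $$\sup_{G\in\mathbb{B}_p(G_0,\varepsilon)}\rho^G(X)=\rho^{G_0}(X)+c\,\varepsilon\qquad\text{for all }G_0\in\mathcal{M}_p(\mathbb{R})\text{ and all }\varepsilon\ge0$$ if and only if there exist $\alpha\in(0,1)$, $a>0$ and $b,d\in\mathbb{R}$ such that $\ell(x)=a\,\ell_\alpha(x-b)+d$ for all $x\in\mathbb{R}$.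
   Context: $\mathcal{M}_p(\mathbb{R})$ is the set of probability distributions on $\mathbb{R}$ with finite $p$-th moment. $\mathbb{E}^G$ denotes expectation when the random variable $X$ has distribution $G$; $\rho^G(X)$ depends only on $G$. The check loss is $\ell_\alpha(u)=u(\alpha-\mathbf{1}_{\{u<0\}})$. $\mathbb{B}_p(G_0,\varepsilon)$ is the set of probability distributions $G$ on $\mathbb{R}$ with $W_p(G,G_0)\le\varepsilon$, where $W_p(F,G)=\inf_\Pi(\mathbb{E}^\Pi|\xi_1-\xi_2|^p)^{1/p}$ over couplings $\Pi$ of $F$ and $G$. *)

theory Defs
  imports "HOL-Probability.Probability"
begin

definition finite_moment_distributions :: "real \<Rightarrow> real measure set" where
  "finite_moment_distributions p =
     {G. real_distribution G \<and> integrable G (\<lambda>x. \<bar>x\<bar> powr p)}"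

(* Expectation with values in [-\<infinity>, \<infinity>]; the Bochner integral would return 0 instead of
   \<infinity> for a loss growing faster than the available moments.  The two parts are never both
   infinite below: see nn_integral_neg_part_finite. *)
definition ext_expectation :: "real measure \<Rightarrow> (real \<Rightarrow> real) \<Rightarrow> ereal" where
  "ext_expectation G f =
     enn2ereal (\<integral>\<^sup>+ x. ennreal (f x) \<partial>G) - enn2ereal (\<integral>\<^sup>+ x. ennreal (- f x) \<partial>G)"

lemma ext_expectation_eq_integral:
  assumes "integrable G f"
  shows "ext_expectation G f = ereal (\<integral>x. f x \<partial>G)"
proof -
  have pos: "(\<integral>\<^sup>+ x. ennreal (f x) \<partial>G) \<noteq> \<infinity>" and neg: "(\<integral>\<^sup>+ x. ennreal (- f x) \<partial>G) \<noteq> \<infinity>"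
    using assms by (auto simp: real_integrable_def)
  obtain u v where "u \<ge> 0" "(\<integral>\<^sup>+ x. ennreal (f x) \<partial>G) = ennreal u"
    and "v \<ge> 0" "(\<integral>\<^sup>+ x. ennreal (- f x) \<partial>G) = ennreal v"
    using pos neg by (metis ennreal_cases infinity_ennreal_def)
  then show ?thesis
    by (simp add: ext_expectation_def real_lebesgue_integral_def[OF assms] enn2ereal_ennreal)
qed

definition loss_risk :: "(real \<Rightarrow> real) \<Rightarrow> real measure \<Rightarrow> ereal" where
  "loss_risk l G = (INF s. ext_expectation G (\<lambda>x. l (x - s)))"

lemma nn_integral_neg_part_finite:
  assumes "convex_on UNIV l" "1 \<le> p" "G \<in> finite_moment_distributions p"
  shows "(\<integral>\<^sup>+ x. ennreal (- l (x - s)) \<partial>G) < \<infinity>"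
proof -
  interpret real_distribution G
    using assms(3) by (simp add: finite_moment_distributions_def)
  define m where "m = Inf ((\<lambda>t. (l 0 - l t) / (0 - t)) ` ({0<..} \<inter> UNIV))"
  have below: "l 0 + m * y \<le> l y" for y
    using convex_le_Inf_differential[OF assms(1), of 0 y] by (simp add: m_def)
  define g where "g x = \<bar>l 0\<bar> + \<bar>m\<bar> * \<bar>s\<bar> + \<bar>m\<bar> * (1 + \<bar>x\<bar> powr p)" for x :: real
  have abs_le: "\<bar>x\<bar> \<le> 1 + \<bar>x\<bar> powr p" for x :: real
  proof (cases "\<bar>x\<bar> \<le> 1")
    case True
    then show ?thesis by (smt (verit) powr_ge_zero)
  next
    case False
    then have "\<bar>x\<bar> powr 1 \<le> \<bar>x\<bar> powr p"
      using assms(2) by (intro powr_mono) auto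
    then show ?thesis using False by simp
  qed
  have "- l (x - s) \<le> g x" for x
  proof -
    have "- (m * (x - s)) \<le> \<bar>m\<bar> * \<bar>x - s\<bar>"
      by (metis abs_ge_minus_self abs_mult)
    also have "\<dots> \<le> \<bar>m\<bar> * (\<bar>s\<bar> + (1 + \<bar>x\<bar> powr p))"
      using abs_le[of x] by (intro mult_left_mono) linarith+
    finally show ?thesis
      using below[of "x - s"] abs_ge_minus_self[of "l 0"] by (simp add: g_def distrib_left)
  qed
  then have "(\<integral>\<^sup>+ x. ennreal (- l (x - s)) \<partial>G) \<le> (\<integral>\<^sup>+ x. ennreal (g x) \<partial>G)"
    by (intro nn_integral_mono ennreal_leI)
  also have "\<dots> < \<infinity>"
  proof -
    have "integrable G g"
      unfolding g_def using assms(3) by (auto simp: finite_moment_distributions_def)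
    then show ?thesis by (simp add: real_integrable_def less_top)
  qed
  finally show ?thesis .
qed

definition check_loss :: "real \<Rightarrow> real \<Rightarrow> real" where
  "check_loss \<alpha> u = u * (\<alpha> - (if u < 0 then 1 else 0))"

definition couplings :: "real measure \<Rightarrow> real measure \<Rightarrow> (real \<times> real) measure set" where
  "couplings F G =
     {Q. prob_space Q \<and> sets Q = sets (borel \<Otimes>\<^sub>M borel) \<and>
         distr Q borel fst = F \<and> distr Q borel snd = G}"

definition ennreal_powr :: "ennreal \<Rightarrow> real \<Rightarrow> ennreal" where
  "ennreal_powr x r = (if x = \<infinity> then \<infinity> else ennreal (enn2real x powr r))"

(* The value is \<infinity> when no coupling has finite p-th order cost. *)
definition wasserstein :: "real \<Rightarrow> real measure \<Rightarrow> real measure \<Rightarrow> ennreal" where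
  "wasserstein p F G =
     (INF Q\<in>couplings F G. ennreal_powr (\<integral>\<^sup>+ z. ennreal (\<bar>fst z - snd z\<bar> powr p) \<partial>Q) (1 / p))"

definition wasserstein_ball :: "real \<Rightarrow> real measure \<Rightarrow> real \<Rightarrow> real measure set" where
  "wasserstein_ball p G0 \<epsilon> = {G. real_distribution G \<and> wasserstein p G G0 \<le> ennreal \<epsilon>}"

end

theory Submission
  imports Defs
begin

text \<open>
  Up to a shift and an additive constant, a positive multiple of a check loss is a pinball loss
  \<open>pinball A B x = max (A * x) (- B * x)\<close> with slopes \<open>A, B > 0\<close>.  Its risk has the dual form
  \<open>sup {E[X Z] | - B \<le> Z \<le> A, E[Z] = 0}\<close>, and an optimal \<open>Z\<close> is a function of \<open>X\<close> that jumps at a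
  quantile (\<open>pinball_risk_multiplier\<close>).  If \<open>X\<close> and \<open>Y\<close> are coupled and \<open>Z\<close> is optimal for \<open>X\<close>, the
  risk of \<open>X\<close> exceeds that of \<open>Y\<close> by at most \<open>E[(X - Y) Z]\<close>.  By Hoelder's inequality this is at most the distance of
  \<open>X\<close> and \<open>Y\<close> times the largest \<open>L\<^sup>q\<close> norm of a feasible \<open>Z\<close>, where \<open>1 / p + 1 / q = 1\<close>; call that
  norm \<open>sensitivity p A B\<close>.  By convexity it is attained by the two-valued \<open>Z\<close> with values \<open>A\<close> and
  \<open>- B\<close>.  Conversely, writing \<open>Y\<close> as its quantile function of a uniform variable, there is always an
  optimal \<open>Z\<close> with these two values, and moving \<open>Y\<close> in the direction dual to \<open>Z\<close> attains the bound.
  Hence the worst-case risk grows exactly linearly (\<open>pinball_risk_ball_SUP\<close>).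

  For the converse only the balls around the Dirac measure at \<open>0\<close> matter.  Let \<open>l\<close> be a convex loss
  whose worst-case risk grows there with rate \<open>c > 0\<close>.  It cannot be monotone, since then \<open>s\<close> could
  drift off to infinity and the risk would be the constant \<open>inf l\<close>.  If affine minorants of \<open>l\<close> have
  slopes \<open>m > 0\<close> and \<open>- m' < 0\<close>, then \<open>l\<close> exceeds a pinball loss minus a constant, and comparing large
  radii gives \<open>sensitivity p m m' \<le> c\<close>.  As the sensitivity is unbounded in each slope, \<open>l\<close> has finite
  asymptotic slopes \<open>A\<close> and \<open>- B\<close>, and \<open>sensitivity p A B \<le> c\<close>.  Moreover \<open>l\<close> has a minimiser \<open>x0\<close> and
  lies below the pinball loss with slopes \<open>A\<close>, \<open>- B\<close> and the same minimum at \<open>x0\<close>.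

  Suppose it is strictly below at some \<open>x0 + t\<close>.  At one particular radius \<open>\<epsilon>\<close> the two-point law that
  is the only maximiser for the pinball loss charges \<open>t\<close>, so \<open>l\<close> has smaller risk there.  To obtain a
  loss of risk that is uniform over the ball, Hoelder's inequality is replaced by Young's inequality
  with its remainder, the pairing gap: a law with small expected gap is close to the two-point law, and
  a law with large gap is suboptimal already for the pinball loss (\<open>strict_gap_loses_risk\<close>).  So the
  worst-case risk at radius \<open>\<epsilon>\<close> would be less than \<open>inf l + sensitivity p A B * \<epsilon> \<le> inf l + c * \<epsilon>\<close>,
  a contradiction.  Therefore \<open>l\<close> is a shifted pinball loss.
\<close>


section \<open>The pinball loss\<close>

definition pinball :: "real \<Rightarrow> real \<Rightarrow> real \<Rightarrow> real" where
  "pinball A B x = max (A * x) (- B * x)"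

lemma pinball_of_nonneg:
  assumes "0 < A" "0 < B" "0 \<le> x"
  shows "pinball A B x = x * A"
proof -
  have "- B * x \<le> 0" "0 \<le> A * x" using assms by simp_all
  then show ?thesis by (simp add: pinball_def max_absorb1 mult.commute)
qed

lemma pinball_of_nonpos:
  assumes "0 < A" "0 < B" "x \<le> 0"
  shows "pinball A B x = x * (- B)"
proof -
  have "A * x \<le> 0" "0 \<le> - B * x" using assms by (simp_all add: mult_nonneg_nonpos)
  then show ?thesis by (simp add: pinball_def max_absorb2 mult.commute)
qed

text \<open>The pinball loss is the support function of the interval from \<open>- B\<close> to \<open>A\<close>; this is weak duality.\<close>
lemma pinball_ge:
  assumes "- B \<le> z" "z \<le> A"
  shows "x * z \<le> pinball A B x"
proof (cases "0 \<le> x")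
  case True
  then have "x * z \<le> x * A" using assms by (intro mult_left_mono) auto
  then show ?thesis by (simp add: pinball_def mult.commute)
next
  case False
  then have "x * z \<le> x * (- B)" using assms by (intro mult_left_mono_neg) auto
  then show ?thesis by (simp add: pinball_def mult.commute)
qed

lemma measurable_pinball [measurable]: "pinball A B \<in> borel_measurable borel"
  unfolding pinball_def by measurable

lemma check_loss_eq_pinball:
  assumes "0 < \<alpha>" "\<alpha> < 1" "0 < a"
  shows "a * check_loss \<alpha> x = pinball (a * \<alpha>) (a * (1 - \<alpha>)) x"
  using pinball_of_nonneg[of "a * \<alpha>" "a * (1 - \<alpha>)" x] pinball_of_nonpos[of "a * \<alpha>" "a * (1 - \<alpha>)" x] assms
  by (cases "x < 0") (auto simp: check_loss_def algebra_simps)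


section \<open>Young's inequality with a strict remainder\<close>

text \<open>The remainder in Young's inequality, normalised so that equality holds at \<open>t = 1\<close>; the general
  inequality \<open>x * A \<le> \<bar>x\<bar> powr p / p + A powr q / q\<close> arises from it by scaling.\<close>
definition young_gap :: "real \<Rightarrow> real \<Rightarrow> real" where
  "young_gap p t = \<bar>t\<bar> powr p / p + (1 - 1 / p) - t"

lemma young_gap_pos:
  assumes "1 < p" "t \<noteq> 1"
  shows "0 < young_gap p t"
proof (cases "t \<le> 0")
  case True
  have "1 / p < 1" using assms by simp
  moreover have "0 \<le> \<bar>t\<bar> powr p / p" using assms by simp
  ultimately show ?thesis using True unfolding young_gap_def by linarith
next
  case False
  define y where "y = t powr p"
  have y: "0 < y" "ln y = p * ln t" using False by (auto simp: y_def ln_powr)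
  define m where "m = y / p + (1 - 1 / p)"
  have p: "0 < 1 / p" "1 / p < 1" using assms by auto
  have mpos: "0 < m" using y p assms unfolding m_def by (simp add: add_pos_pos)
  have "y \<noteq> 1"
    using assms False y ln_eq_zero_iff[of t] ln_eq_zero_iff[of y] by auto
  \<comment> \<open>This is the weighted arithmetic-geometric mean inequality for \<open>y\<close> and \<open>1\<close>, whose arithmetic
    mean is \<open>m\<close>: it comes from \<open>ln u \<le> u - 1\<close> at \<open>y / m\<close> and at \<open>1 / m\<close>, strict at the latter.\<close>
  have l1: "ln (1 / m) < 1 / m - 1"
  proof -
    have "1 / m \<noteq> 1"
    proof
      assume "1 / m = 1"
      then have "m = 1" by simp
      then have "y / p = 1 / p" by (simp add: m_def)
      then show False using \<open>y \<noteq> 1\<close> assms by simp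
    qed
    then show ?thesis
      using ln_eq_minus_one[of "1 / m"] ln_le_minus_one[of "1 / m"] mpos by force
  qed
  have l2: "ln (y / m) \<le> y / m - 1" using ln_le_minus_one[of "y / m"] y mpos by simp
  have "(1 / p) * ln (y / m) + (1 - 1 / p) * ln (1 / m)
      < (1 / p) * (y / m - 1) + (1 - 1 / p) * (1 / m - 1)"
    using l1 l2 p by (intro add_le_less_mono mult_left_mono mult_strict_left_mono) auto
  also have "\<dots> = (y / p + (1 - 1 / p)) / m - 1"
    using mpos assms by (simp add: field_simps)
  also have "\<dots> = 0" using mpos by (simp add: m_def[symmetric])
  also have "(1 / p) * ln (y / m) + (1 - 1 / p) * ln (1 / m) = ln t - ln m"
    using y mpos assms by (simp add: ln_div) (simp add: field_simps)
  finally have "t < m" using False mpos by simp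
  then show ?thesis using False by (simp add: young_gap_def m_def y_def)
qed

lemma young_gap_1: "young_gap p 1 = 0"
  by (simp add: young_gap_def)

lemma young_gap_nonneg: "1 < p \<Longrightarrow> 0 \<le> young_gap p t"
  using young_gap_pos[of p t] young_gap_1[of p] by (cases "t = 1") auto

text \<open>For \<open>x \<noteq> 0\<close> this is nonnegativity of the Young remainder at \<open>y / x\<close>, multiplied by
  \<open>p * \<bar>x\<bar> powr p\<close>.\<close>
lemma abs_powr_tangent:
  fixes p x y :: real
  assumes "1 < p"
  shows "\<bar>x\<bar> powr p + p * \<bar>x\<bar> powr (p - 1) * sgn x * (y - x) \<le> \<bar>y\<bar> powr p"
proof (cases "x = 0")
  case False
  have "0 \<le> young_gap p (y / x) * (p * \<bar>x\<bar> powr p)"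
    using young_gap_nonneg[OF assms] assms by simp
  also have "\<dots> = \<bar>y / x\<bar> powr p * \<bar>x\<bar> powr p + (p - 1) * \<bar>x\<bar> powr p - p * (\<bar>x\<bar> powr p * (y / x))"
    using assms by (simp add: young_gap_def field_simps)
  also have "\<bar>y / x\<bar> powr p * \<bar>x\<bar> powr p = \<bar>y\<bar> powr p"
    using False by (simp add: powr_mult[symmetric])
  also have "\<bar>x\<bar> powr p * (y / x) = \<bar>x\<bar> powr (p - 1) * sgn x * y"
    using False by (simp add: powr_diff abs_real_def sgn_real_def)
  finally have "\<bar>x\<bar> powr p - p * \<bar>x\<bar> powr p + p * \<bar>x\<bar> powr (p - 1) * sgn x * y \<le> \<bar>y\<bar> powr p"
    by (simp add: algebra_simps)
  moreover have "\<bar>x\<bar> powr (p - 1) * sgn x * x = \<bar>x\<bar> powr p"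
    using False by (simp add: powr_diff abs_real_def sgn_real_def)
  ultimately show ?thesis by (simp add: algebra_simps)
qed (use assms in simp)

text \<open>A function with a supporting line at every point is convex.\<close>
lemma convex_abs_powr:
  assumes "1 < p"
  shows "convex_on UNIV (\<lambda>x::real. \<bar>x\<bar> powr p)"
proof (rule convex_onI)
  fix t x y :: real
  assume t: "0 < t" "t < 1"
  define z where "z = (1 - t) *\<^sub>R x + t *\<^sub>R y"
  define m where "m = p * \<bar>z\<bar> powr (p - 1) * sgn z"
  have 1: "\<bar>z\<bar> powr p + m * (x - z) \<le> \<bar>x\<bar> powr p" and 2: "\<bar>z\<bar> powr p + m * (y - z) \<le> \<bar>y\<bar> powr p"
    using abs_powr_tangent[OF assms, of z] unfolding m_def by auto
  have "(1 - t) * (\<bar>z\<bar> powr p + m * (x - z)) + t * (\<bar>z\<bar> powr p + m * (y - z))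
      \<le> (1 - t) * \<bar>x\<bar> powr p + t * \<bar>y\<bar> powr p"
    using 1 2 t by (intro add_mono mult_left_mono) auto
  moreover have "(1 - t) * (\<bar>z\<bar> powr p + m * (x - z)) + t * (\<bar>z\<bar> powr p + m * (y - z)) = \<bar>z\<bar> powr p"
    by (simp add: z_def algebra_simps)
  ultimately show "\<bar>(1 - t) *\<^sub>R x + t *\<^sub>R y\<bar> powr p \<le> (1 - t) * \<bar>x\<bar> powr p + t * \<bar>y\<bar> powr p"
    by (simp add: z_def)
qed simp

lemma convex_young_gap:
  assumes "1 < p"
  shows "convex_on UNIV (young_gap p)"
proof -
  have "convex_on UNIV (\<lambda>t::real. (1 - 1 / p) - t)"
    by (rule convex_onI) (simp_all add: algebra_simps diff_divide_distrib)
  then have "convex_on UNIV (\<lambda>t::real. (1 / p) * \<bar>t\<bar> powr p + ((1 - 1 / p) - t))"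
    using assms by (intro convex_on_add convex_on_cmul convex_abs_powr) simp_all
  then show ?thesis by (simp add: young_gap_def[abs_def] algebra_simps)
qed

text \<open>A nonnegative convex function that vanishes only at \<open>1\<close> grows at least linearly away from \<open>1\<close>.
  This makes near-equality in Young's inequality quantitative.\<close>
lemma young_gap_controls_distance:
  assumes "1 < p" "0 < \<eta>"
  obtains C where "0 \<le> C" "\<And>t. \<bar>t - 1\<bar> \<le> \<eta> + C * young_gap p t"
proof -
  define \<mu> where "\<mu> = min (young_gap p (1 + \<eta>)) (young_gap p (1 - \<eta>))"
  have \<mu>: "0 < \<mu>" using young_gap_pos[OF assms(1)] assms(2) by (simp add: \<mu>_def)
  have "\<bar>t - 1\<bar> \<le> \<eta> + (\<eta> / \<mu>) * young_gap p t" for t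
  proof (cases "\<bar>t - 1\<bar> \<le> \<eta>")
    case True
    then show ?thesis using young_gap_nonneg[OF assms(1), of t] \<mu> assms(2)
      by (smt (verit) divide_nonneg_nonneg mult_nonneg_nonneg)
  next
    case False
    \<comment> \<open>The point at distance \<open>\<eta>\<close> from \<open>1\<close> in the direction of \<open>t\<close>, as a convex combination.\<close>
    define w where "w = \<eta> / \<bar>t - 1\<bar>"
    have w: "0 \<le> w" "w \<le> 1" using False assms(2) by (auto simp: w_def)
    have eq: "(1 - w) *\<^sub>R 1 + w *\<^sub>R t = 1 + w * (t - 1)"
      by (simp add: algebra_simps)
    have "w * (t - 1) = \<eta> \<or> w * (t - 1) = - \<eta>"
      using False assms(2) by (auto simp: w_def field_simps abs_real_def)
    then have "\<mu> \<le> young_gap p ((1 - w) *\<^sub>R 1 + w *\<^sub>R t)"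
      unfolding eq \<mu>_def by (elim disjE) simp_all
    also have "\<dots> \<le> (1 - w) * young_gap p 1 + w * young_gap p t"
      using w by (intro convex_onD[OF convex_young_gap[OF assms(1)]]) auto
    also have "\<dots> = \<eta> * young_gap p t / \<bar>t - 1\<bar>" by (simp add: young_gap_1 w_def)
    finally have "\<mu> * \<bar>t - 1\<bar> \<le> \<eta> * young_gap p t"
      using False assms(2) by (simp add: pos_le_divide_eq)
    then have "\<bar>t - 1\<bar> \<le> (\<eta> / \<mu>) * young_gap p t"
      using \<mu> by (simp add: pos_le_divide_eq mult.commute)
    then show ?thesis using assms(2) by simp
  qed
  then show ?thesis using \<mu> assms(2) by (intro that[of "\<eta> / \<mu>"]) auto
qed


section \<open>The sensitivity constant\<close>

text \<open>With \<open>q = p / (p - 1)\<close>, this is the \<open>q\<close>-th absolute moment of the centred law on \<open>A\<close> and \<open>- B\<close>,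
  which gives mass \<open>B / (A + B)\<close> to \<open>A\<close>.  The form avoids \<open>q\<close> by means of
  \<open>A powr q = A * A powr (1 / (p - 1))\<close>.\<close>
definition dual_moment :: "real \<Rightarrow> real \<Rightarrow> real \<Rightarrow> real" where
  "dual_moment p A B = A * B * (A powr (1 / (p - 1)) + B powr (1 / (p - 1))) / (A + B)"

text \<open>The \<open>L\<^sup>q\<close> norm of the same law, since \<open>1 / q = 1 - 1 / p\<close>.\<close>
definition sensitivity :: "real \<Rightarrow> real \<Rightarrow> real \<Rightarrow> real" where
  "sensitivity p A B = dual_moment p A B powr (1 - 1 / p)"

lemma dual_moment_pos: "0 < A \<Longrightarrow> 0 < B \<Longrightarrow> 0 < dual_moment p A B"
  by (simp add: dual_moment_def add_pos_pos)

lemma sensitivity_pos: "0 < A \<Longrightarrow> 0 < B \<Longrightarrow> 0 < sensitivity p A B"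
  using dual_moment_pos[of A B p] by (simp add: sensitivity_def)

lemma sensitivity_commute: "sensitivity p A B = sensitivity p B A"
  by (simp add: sensitivity_def dual_moment_def add.commute mult.commute)

text \<open>The centred two-valued \<open>Z\<close> with values \<open>A\<close> and \<open>- B\<close> has the dual direction
  \<open>sgn Z * \<bar>Z\<bar> powr (1 / (p - 1))\<close>; this is the factor that gives the direction the \<open>L\<^sup>p\<close> norm \<open>\<epsilon>\<close>.\<close>
definition optimal_scale :: "real \<Rightarrow> real \<Rightarrow> real \<Rightarrow> real \<Rightarrow> real" where
  "optimal_scale p A B \<epsilon> = \<epsilon> * dual_moment p A B powr (- 1 / p)"

lemma optimal_scale:
  assumes "1 < p" "0 < A" "0 < B"
  shows "optimal_scale p A B \<epsilon> * dual_moment p A B = sensitivity p A B * \<epsilon>"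
    and "0 \<le> \<epsilon> \<Longrightarrow> optimal_scale p A B \<epsilon> powr p * dual_moment p A B = \<epsilon> powr p"
proof -
  define V where "V = dual_moment p A B"
  have V: "0 < V" using dual_moment_pos assms by (simp add: V_def)
  have "V powr (- 1 / p) * V = V powr (1 - 1 / p)"
    using powr_add[of V "- 1 / p" 1] V by simp
  then show "optimal_scale p A B \<epsilon> * dual_moment p A B = sensitivity p A B * \<epsilon>"
    by (simp add: optimal_scale_def sensitivity_def V_def)
  assume "0 \<le> \<epsilon>"
  then show "optimal_scale p A B \<epsilon> powr p * dual_moment p A B = \<epsilon> powr p"
    using V assms powr_powr[of V "- 1 / p" p] powr_neg_one[of V]
    by (simp add: optimal_scale_def V_def[symmetric] powr_mult)
qed

lemma powr_conjugate:
  assumes "1 < p" "0 < (A::real)"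
  shows "(A powr (1 / (p - 1))) powr p = A * A powr (1 / (p - 1))"
proof -
  have "p / (p - 1) = 1 + 1 / (p - 1)" using assms by (simp add: field_simps)
  then show ?thesis using assms by (simp add: powr_powr powr_add)
qed

lemma scaled_young_gap:
  assumes "1 < p" "0 < A" "0 < \<kappa>"
  defines "a \<equiv> A powr (1 / (p - 1))"
  shows "\<kappa> * A * a * young_gap p (x / (\<kappa> * a))
       = \<kappa> powr (1 - p) * \<bar>x\<bar> powr p / p + (1 - 1 / p) * \<kappa> * A * a - A * x"
proof -
  have a: "0 < a" "a powr p = A * a" using assms powr_conjugate[of p A] by (auto simp: a_def)
  have "\<kappa> * A * a * (\<bar>x / (\<kappa> * a)\<bar> powr p) = (\<kappa> * (A * a)) * \<bar>x\<bar> powr p / (\<kappa> powr p * a powr p)"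
    using assms a by (simp add: powr_divide abs_mult powr_mult)
  also have "\<dots> = \<kappa> powr (1 - p) * \<bar>x\<bar> powr p"
    using assms a by (simp add: powr_diff)
  finally have 1: "\<kappa> * A * a * (\<bar>x / (\<kappa> * a)\<bar> powr p) = \<kappa> powr (1 - p) * \<bar>x\<bar> powr p" .
  have 2: "\<kappa> * A * a * (x / (\<kappa> * a)) = A * x" using assms a by simp
  show ?thesis
    unfolding young_gap_def right_diff_distrib distrib_left 2
    using 1 by (simp add: left_diff_distrib)
qed

text \<open>The gap in the inequality between \<open>x * z\<close> and its upper bound: Young's bound with \<open>\<bar>z\<bar> powr q\<close>
  replaced by its chord over the interval from \<open>- B\<close> to \<open>A\<close>.  The chord makes the gap affine in \<open>z\<close>, so
  it is the convex combination of the Young remainders at the two end points, as written here.  It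
  also makes the expectation of the bound depend on a centred \<open>z\<close> only through \<open>dual_moment p A B\<close>.\<close>
definition pairing_gap :: "real \<Rightarrow> real \<Rightarrow> real \<Rightarrow> real \<Rightarrow> real \<Rightarrow> real \<Rightarrow> real" where
  "pairing_gap p A B \<kappa> x z =
     (z + B) / (A + B) *
       (\<kappa> * A * A powr (1 / (p - 1)) * young_gap p (x / (\<kappa> * A powr (1 / (p - 1))))) +
     (A - z) / (A + B) *
       (\<kappa> * B * B powr (1 / (p - 1)) * young_gap p (- x / (\<kappa> * B powr (1 / (p - 1)))))"

lemma pairing_gap_nonneg:
  assumes "1 < p" "0 < A" "0 < B" "0 < \<kappa>" "- B \<le> z" "z \<le> A"
  shows "0 \<le> pairing_gap p A B \<kappa> x z"
proof -
  have "0 \<le> (z + B) / (A + B)" "0 \<le> (A - z) / (A + B)" using assms by auto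
  then show ?thesis
    using assms young_gap_nonneg[OF assms(1)] unfolding pairing_gap_def
    by (intro add_nonneg_nonneg[OF mult_nonneg_nonneg mult_nonneg_nonneg] mult_nonneg_nonneg) auto
qed

lemma pairing_gap_eq:
  assumes "1 < p" "0 < A" "0 < B" "0 < \<kappa>"
  defines "a \<equiv> A powr (1 / (p - 1))" and "b \<equiv> B powr (1 / (p - 1))"
  shows "pairing_gap p A B \<kappa> x z = \<kappa> powr (1 - p) * \<bar>x\<bar> powr p / p
           + (1 - 1 / p) * \<kappa> * (dual_moment p A B + z * (A * a - B * b) / (A + B)) - x * z"
proof -
  define P where "P = \<kappa> powr (1 - p) * \<bar>x\<bar> powr p / p"
  define k where "k = (1 - 1 / p) * \<kappa>"
  have 1: "\<kappa> * A * a * young_gap p (x / (\<kappa> * a)) = P + k * A * a - A * x"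
    using scaled_young_gap[of p A \<kappa> x] assms by (simp add: P_def k_def)
  have 2: "\<kappa> * B * b * young_gap p (- x / (\<kappa> * b)) = P + k * B * b + B * x"
    using scaled_young_gap[of p B \<kappa> "- x"] assms by (simp add: P_def k_def)
  have "pairing_gap p A B \<kappa> x z
      = (z + B) / (A + B) * (P + k * A * a - A * x) + (A - z) / (A + B) * (P + k * B * b + B * x)"
    unfolding pairing_gap_def a_def[symmetric] b_def[symmetric] 1 2 ..
  also have "\<dots> = P + k * (A * B * (a + b) / (A + B) + z * (A * a - B * b) / (A + B)) - x * z"
  proof -
    have S: "A + B \<noteq> 0" using assms by simp
    have "(z + B) * (P + k * A * a - A * x) + (A - z) * (P + k * B * b + B * x)
        = P * (A + B) + k * (A * B * (a + b) + z * (A * a - B * b)) - x * z * (A + B)"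
      by (simp add: algebra_simps)
    then have "((z + B) * (P + k * A * a - A * x) + (A - z) * (P + k * B * b + B * x)) / (A + B)
        = (P * (A + B) + k * (A * B * (a + b) + z * (A * a - B * b)) - x * z * (A + B)) / (A + B)"
      by simp
    also have "\<dots> = P * (A + B) / (A + B) + k * (A * B * (a + b) + z * (A * a - B * b)) / (A + B)
        - x * z * (A + B) / (A + B)"
      by (simp only: add_divide_distrib diff_divide_distrib)
    also have "\<dots> = P + k * ((A * B * (a + b) + z * (A * a - B * b)) / (A + B)) - x * z"
      using S by simp
    finally show ?thesis by (simp only: times_divide_eq_left flip: add_divide_distrib)
  qed
  finally show ?thesis by (simp add: P_def k_def dual_moment_def a_def b_def)
qed

text \<open>Growth of order \<open>p \<ge> 1\<close> dominates linear growth on a probability space.\<close>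
lemma (in prob_space) integrable_of_abs_powr:
  fixes X :: "'a \<Rightarrow> real"
  assumes "1 < p" "X \<in> borel_measurable M" "integrable M (\<lambda>x. \<bar>X x\<bar> powr p)"
  shows "integrable M X"
proof (rule Bochner_Integration.integrable_bound)
  show "integrable M (\<lambda>x. 1 + \<bar>X x\<bar> powr p)" using assms by simp
  have "\<bar>y\<bar> \<le> 1 + \<bar>y\<bar> powr p" for y :: real
  proof (cases "\<bar>y\<bar> \<le> 1")
    case True
    then show ?thesis by (smt (verit) powr_ge_zero)
  next
    case False
    then have "\<bar>y\<bar> powr 1 \<le> \<bar>y\<bar> powr p"
      using assms(1) by (intro powr_mono) auto
    then show ?thesis using False by simp
  qed
  then show "AE x in M. norm (X x) \<le> norm (1 + \<bar>X x\<bar> powr p)"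
    by (auto intro!: AE_I2 intro: order_trans[OF _ abs_ge_self])
qed fact

lemma integrable_abs_powr_add:
  fixes X Y :: "'a \<Rightarrow> real"
  assumes "0 < p" "integrable M (\<lambda>x. \<bar>X x\<bar> powr p)" "integrable M (\<lambda>x. \<bar>Y x\<bar> powr p)"
    and [measurable]: "X \<in> borel_measurable M" "Y \<in> borel_measurable M"
  shows "integrable M (\<lambda>x. \<bar>X x + Y x\<bar> powr p)"
proof (rule Bochner_Integration.integrable_bound)
  show "integrable M (\<lambda>x. 2 powr p * (\<bar>X x\<bar> powr p + \<bar>Y x\<bar> powr p))" using assms by simp
  have "\<bar>u + v\<bar> powr p \<le> 2 powr p * (\<bar>u\<bar> powr p + \<bar>v\<bar> powr p)" for u v :: real
  proof -
    have "\<bar>u + v\<bar> powr p \<le> (2 * max \<bar>u\<bar> \<bar>v\<bar>) powr p"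
      using assms(1) by (intro powr_mono2) auto
    also have "\<dots> = 2 powr p * max \<bar>u\<bar> \<bar>v\<bar> powr p" by (rule powr_mult)
    also have "\<dots> \<le> 2 powr p * (\<bar>u\<bar> powr p + \<bar>v\<bar> powr p)"
      by (intro mult_left_mono) (auto simp: max_def)
    finally show ?thesis .
  qed
  then show "AE x in M. norm (\<bar>X x + Y x\<bar> powr p)
      \<le> norm (2 powr p * (\<bar>X x\<bar> powr p + \<bar>Y x\<bar> powr p))"
    by (intro AE_I2) simp
qed simp

lemma (in prob_space) integrable_mult_bounded:
  fixes X Z :: "'a \<Rightarrow> real"
  assumes "integrable M X" and [measurable]: "Z \<in> borel_measurable M"
    and "\<And>x. - B \<le> Z x" "\<And>x. Z x \<le> A"
  shows "integrable M (\<lambda>x. X x * Z x)" and "integrable M Z"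
proof -
  have Z: "\<bar>Z x\<bar> \<le> \<bar>A\<bar> + \<bar>B\<bar>" for x using assms(3,4)[of x] by linarith
  have [measurable]: "X \<in> borel_measurable M" using assms(1) by simp
  show "integrable M Z" using Z by (intro integrable_const_bound[of _ "\<bar>A\<bar> + \<bar>B\<bar>"]) auto
  show "integrable M (\<lambda>x. X x * Z x)"
  proof (rule Bochner_Integration.integrable_bound)
    show "integrable M (\<lambda>x. (\<bar>A\<bar> + \<bar>B\<bar>) * X x)" using assms by simp
    show "AE x in M. norm (X x * Z x) \<le> norm ((\<bar>A\<bar> + \<bar>B\<bar>) * X x)"
      using Z by (intro AE_I2) (auto simp: abs_mult mult.commute intro!: mult_left_mono)
  qed simp
qed

text \<open>Hoelder's inequality for centred \<open>Z\<close> in the interval from \<open>- B\<close> to \<open>A\<close>, with the convexity bound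
  for its \<open>q\<close>-th moment built in and with the remainder kept on the left-hand side.\<close>
lemma (in prob_space) pairing_le:
  fixes X Z :: "'a \<Rightarrow> real"
  assumes pAB: "1 < p" "0 < A" "0 < B" "0 < \<kappa>"
    and [measurable]: "X \<in> borel_measurable M" "Z \<in> borel_measurable M"
    and Xp: "integrable M (\<lambda>x. \<bar>X x\<bar> powr p)"
    and Z: "\<And>x. - B \<le> Z x" "\<And>x. Z x \<le> A" "expectation Z = 0"
    and moment: "expectation (\<lambda>x. \<bar>X x\<bar> powr p) \<le> \<kappa> powr p * dual_moment p A B"
  shows "integrable M (\<lambda>x. pairing_gap p A B \<kappa> (X x) (Z x))"
    and "expectation (\<lambda>x. X x * Z x) + expectation (\<lambda>x. pairing_gap p A B \<kappa> (X x) (Z x))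
         \<le> \<kappa> * dual_moment p A B"
proof -
  note XZ = integrable_mult_bounded[OF integrable_of_abs_powr[OF pAB(1) assms(5) Xp] assms(6) Z(1,2)]
  define V where "V = dual_moment p A B"
  define D where "D = (A * A powr (1 / (p - 1)) - B * B powr (1 / (p - 1))) / (A + B)"
  define k where "k = \<kappa> powr (1 - p) / p"
  define m where "m = (1 - 1 / p) * \<kappa>"
  have gap: "pairing_gap p A B \<kappa> x z = k * \<bar>x\<bar> powr p + m * V + m * D * z - x * z" for x z
  proof -
    have "pairing_gap p A B \<kappa> x z = k * \<bar>x\<bar> powr p + m * (V + z * D) - x * z"
      using pairing_gap_eq[OF pAB] by (simp add: k_def D_def V_def m_def)
    then show ?thesis by (simp add: distrib_left)
  qed
  show "integrable M (\<lambda>x. pairing_gap p A B \<kappa> (X x) (Z x))"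
    unfolding gap using Xp XZ by simp
  have "expectation (\<lambda>x. pairing_gap p A B \<kappa> (X x) (Z x))
      = k * expectation (\<lambda>x. \<bar>X x\<bar> powr p) + m * V - expectation (\<lambda>x. X x * Z x)"
    unfolding gap using Xp XZ Z(3) by (simp add: prob_space)
  moreover have "k * expectation (\<lambda>x. \<bar>X x\<bar> powr p) \<le> k * (\<kappa> powr p * V)"
    using moment pAB by (intro mult_left_mono) (auto simp: k_def V_def)
  moreover have "k * (\<kappa> powr p * V) = \<kappa> * V / p"
    using pAB by (simp add: k_def powr_diff)
  moreover have "m * V = \<kappa> * V - \<kappa> * V / p" by (simp add: m_def left_diff_distrib)
  ultimately show "expectation (\<lambda>x. X x * Z x) + expectation (\<lambda>x. pairing_gap p A B \<kappa> (X x) (Z x))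
      \<le> \<kappa> * dual_moment p A B"
    unfolding V_def[symmetric] by linarith
qed


section \<open>Quantiles and the dual form of the risk\<close>

text \<open>The first-order condition at a quantile \<open>s\<close> of level \<open>A / (A + B)\<close>: the subdifferential of the
  pinball loss has a centred selection.\<close>
lemma balanced_multiplier:
  assumes "real_distribution G" "0 < A" "0 < B"
  obtains s z where "z \<in> borel_measurable borel" "\<And>x::real. - B \<le> z x" "\<And>x. z x \<le> A"
    "(\<integral>x. z x \<partial>G) = 0" "\<And>x. (x - s) * z x = pinball A B (x - s)"
proof -
  interpret cdf_distribution G using assms(1) by (simp add: cdf_distribution_def)
  define \<theta> where "\<theta> = A / (A + B)"
  have \<theta>: "0 < \<theta>" "\<theta> < 1" using assms by (auto simp: \<theta>_def)
  define s where "s = I \<theta>"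
  define L where "L = measure G {..<s}"
  define R where "R = measure G {s<..}"
  define E where "E = measure G {s}"
  have "\<theta> \<le> C s" using pseudoinverse[OF \<theta>, of s] by (simp add: s_def)
  moreover have "C s + R = 1"
    using prob_compl[of "{..s}"] by (simp add: cdf_def R_def borel_UNIV Compl_eq_Diff_UNIV[symmetric])
  moreover have "C s = L + E"
    unfolding cdf_def L_def E_def by (subst finite_measure_Union[symmetric]) (auto intro: arg_cong[where f="measure G"])
  moreover have "L \<le> \<theta>"
  proof (rule tendsto_upperbound)
    show "(C \<longlongrightarrow> L) (at_left s)" unfolding L_def by (rule cdf_at_left)
    show "\<forall>\<^sub>F x in at_left s. C x \<le> \<theta>"
    proof (rule eventually_at_leftI[of "s - 1"])
      fix x assume "x \<in> {s - 1<..<s}"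
      then show "C x \<le> \<theta>" using pseudoinverse[OF \<theta>, of x] by (auto simp: s_def)
    qed simp
  qed simp
  moreover have "0 \<le> E" "0 \<le> L" "0 \<le> R" by (auto simp: E_def L_def R_def)
  ultimately have LR: "L + R + E = 1" "L \<le> \<theta>" "R \<le> 1 - \<theta>" "0 \<le> E" "0 \<le> L" "0 \<le> R" by linarith+
  \<comment> \<open>The value on the atom at \<open>s\<close> absorbs the imbalance of the two open half-lines; if \<open>s\<close> is not an
    atom there is no imbalance and the default value \<open>0\<close> of the division is fine.\<close>
  define z0 where "z0 = (B * L - A * R) / E"
  have AB: "(A + B) * L \<le> A" "(A + B) * R \<le> B"
    using LR assms by (auto simp: \<theta>_def field_simps)
  have z0: "- B \<le> z0 \<and> z0 \<le> A \<and> z0 * E = B * L - A * R"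
  proof (cases "E = 0")
    case True
    then have "L = \<theta>" "R = 1 - \<theta>" using LR by linarith+
    moreover have "B * \<theta> = A * (1 - \<theta>)" using assms by (simp add: \<theta>_def field_simps)
    ultimately have "B * L - A * R = 0" by simp
    then show ?thesis using True assms by (simp add: z0_def)
  next
    case False
    then have "0 < E" using LR by simp
    have E: "E = 1 - L - R" using LR by simp
    have "- B * E \<le> B * L - A * R" "B * L - A * R \<le> A * E"
      using AB by (simp_all add: E algebra_simps)
    then show ?thesis using \<open>0 < E\<close> by (simp add: z0_def pos_le_divide_eq pos_divide_le_eq)
  qed
  define z where "z x = A * indicator {s<..} x + (- B) * indicator {..<s} x + z0 * indicator {s} x" for x
  show ?thesis
  proof (rule that[of z s])
    show "z \<in> borel_measurable borel" unfolding z_def by measurable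
    show "- B \<le> z x" "z x \<le> A" for x using z0 assms by (auto simp: z_def indicator_def)
    show "(x - s) * z x = pinball A B (x - s)" for x
      using pinball_of_nonneg[OF assms(2,3), of "x - s"] pinball_of_nonpos[OF assms(2,3), of "x - s"]
      by (cases x s rule: linorder_cases) (auto simp: z_def)
    have [simp]: "integrable G (indicat_real S)" if "S \<in> sets borel" for S
      using that by (intro integrable_const_bound[of _ 1]) auto
    have "(\<integral>x. z x \<partial>G) = A * R - B * L + z0 * E"
      unfolding z_def R_def L_def E_def by (simp add: borel_UNIV)
    then show "(\<integral>x. z x \<partial>G) = 0" using z0 by simp
  qed
qed

lemma finite_moment_real_distribution:
  "G \<in> finite_moment_distributions p \<Longrightarrow> real_distribution G"
  by (simp add: finite_moment_distributions_def)

lemma finite_moment_integrable: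
  assumes "1 < p" "G \<in> finite_moment_distributions p"
  shows "integrable G (\<lambda>x. x)"
proof -
  interpret real_distribution G using assms(2) by (rule finite_moment_real_distribution)
  show ?thesis
    by (rule integrable_of_abs_powr[OF assms(1)])
       (use assms(2) in \<open>auto simp: finite_moment_distributions_def\<close>)
qed

lemma (in prob_space) integrable_pinball:
  assumes "integrable M X"
  shows "integrable M (\<lambda>x. pinball A B (X x - s))"
  unfolding pinball_def using assms by (intro integrable_max) auto

lemma loss_risk_le_expectation:
  assumes "integrable G (\<lambda>x. l (x - s))"
  shows "loss_risk l G \<le> ereal (\<integral>x. l (x - s) \<partial>G)"
  unfolding loss_risk_def using ext_expectation_eq_integral[OF assms]
  by (metis INF_lower UNIV_I)

text \<open>A centred multiplier does not see the shift \<open>s\<close>, so weak duality holds for all shifts at once.  The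
  multiplier need not be a function of \<open>Y\<close>, which lets multipliers be transported along couplings.\<close>
lemma (in prob_space) pinball_risk_ge:
  fixes Y Z :: "'a \<Rightarrow> real"
  assumes Y: "integrable M Y" and Z[measurable]: "Z \<in> borel_measurable M"
    and bounds: "\<And>x. - B \<le> Z x" "\<And>x. Z x \<le> A" and mean: "expectation Z = 0"
  shows "ereal (expectation (\<lambda>x. Y x * Z x)) \<le> loss_risk (pinball A B) (distr M borel Y)"
  unfolding loss_risk_def
proof (rule INF_greatest)
  fix s
  have [measurable]: "Y \<in> borel_measurable M" using Y by simp
  note YZ = integrable_mult_bounded[OF Y Z bounds]
  have "expectation (\<lambda>x. Y x * Z x) = expectation (\<lambda>x. (Y x - s) * Z x)"
    using YZ mean by (simp add: left_diff_distrib)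
  also have "\<dots> \<le> expectation (\<lambda>x. pinball A B (Y x - s))"
  proof (rule integral_mono)
    show "integrable M (\<lambda>x. (Y x - s) * Z x)" using YZ by (simp add: left_diff_distrib)
    show "integrable M (\<lambda>x. pinball A B (Y x - s))" by (rule integrable_pinball[OF Y])
    show "(Y x - s) * Z x \<le> pinball A B (Y x - s)" for x by (rule pinball_ge[OF bounds])
  qed
  also have "\<dots> = (\<integral>x. pinball A B (x - s) \<partial>distr M borel Y)"
    by (subst integral_distr) auto
  finally show "ereal (expectation (\<lambda>x. Y x * Z x))
      \<le> ext_expectation (distr M borel Y) (\<lambda>x. pinball A B (x - s))"
    using integrable_pinball[OF Y, of A B s]
    by (subst ext_expectation_eq_integral) (auto simp: integrable_distr_eq)
qed

text \<open>Strong duality, with the multiplier at a quantile.\<close>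
lemma pinball_risk_multiplier:
  assumes "1 < p" "0 < A" "0 < B" "G \<in> finite_moment_distributions p"
  obtains s z where "z \<in> borel_measurable borel" "\<And>x::real. - B \<le> z x" "\<And>x. z x \<le> A"
    "(\<integral>x. z x \<partial>G) = 0" "(\<integral>x. pinball A B (x - s) \<partial>G) = (\<integral>x. x * z x \<partial>G)"
    "loss_risk (pinball A B) G = ereal (\<integral>x. x * z x \<partial>G)"
proof -
  interpret real_distribution G using assms(4) by (rule finite_moment_real_distribution)
  note X = finite_moment_integrable[OF assms(1,4)]
  obtain s z where z: "z \<in> borel_measurable borel" "\<And>x::real. - B \<le> z x" "\<And>x. z x \<le> A"
    "(\<integral>x. z x \<partial>G) = 0" "\<And>x. (x - s) * z x = pinball A B (x - s)"
    using balanced_multiplier[OF real_distribution_axioms assms(2,3)] by metis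
  have zm: "z \<in> borel_measurable G" using z(1) by simp
  note Xz = integrable_mult_bounded[OF X zm z(2,3)]
  have eq: "(\<integral>x. pinball A B (x - s) \<partial>G) = (\<integral>x. x * z x \<partial>G)"
    using Xz z(4) by (simp add: z(5)[symmetric] left_diff_distrib)
  have "distr G borel (\<lambda>x. x) = G"
    using distr_id2[of borel G] by simp
  then have "ereal (\<integral>x. x * z x \<partial>G) \<le> loss_risk (pinball A B) G"
    using pinball_risk_ge[OF X zm z(2,3,4)] by simp
  moreover have "loss_risk (pinball A B) G \<le> ereal (\<integral>x. x * z x \<partial>G)"
    using loss_risk_le_expectation[where l="pinball A B" and s=s and G=G] integrable_pinball[OF X]
    by (simp add: eq)
  ultimately show ?thesis using that[of z s] z eq by (simp add: antisym)
qed


section \<open>Wasserstein balls\<close>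

lemma couplings_props:
  assumes "Q \<in> couplings F G"
  shows "prob_space Q" "fst \<in> borel_measurable Q" "snd \<in> borel_measurable Q"
    "distr Q borel fst = F" "distr Q borel snd = G"
  using assms by (auto simp: couplings_def cong: measurable_cong_sets)

lemma wasserstein_ball_coupling:
  assumes "1 < p" "0 \<le> \<epsilon>" "\<epsilon> < \<delta>" "G \<in> wasserstein_ball p G0 \<epsilon>"
  obtains Q where "Q \<in> couplings G G0" "integrable Q (\<lambda>z. \<bar>fst z - snd z\<bar> powr p)"
    "(\<integral>z. \<bar>fst z - snd z\<bar> powr p \<partial>Q) \<le> \<delta> powr p"
proof -
  have "wasserstein p G G0 < ennreal \<delta>"
    using assms by (auto simp: wasserstein_ball_def intro: le_less_trans ennreal_lessI)
  then obtain Q where Q: "Q \<in> couplings G G0"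
    and less: "ennreal_powr (\<integral>\<^sup>+ z. ennreal (\<bar>fst z - snd z\<bar> powr p) \<partial>Q) (1 / p) < ennreal \<delta>"
    unfolding wasserstein_def INF_less_iff by blast
  note [measurable] = couplings_props(2,3)[OF Q]
  define I where "I = (\<integral>\<^sup>+ z. ennreal (\<bar>fst z - snd z\<bar> powr p) \<partial>Q)"
  have fin: "I \<noteq> \<infinity>" using less by (auto simp: ennreal_powr_def I_def[symmetric] split: if_splits)
  then have "I < \<infinity>" by (simp add: less_top)
  then have int: "integrable Q (\<lambda>z. \<bar>fst z - snd z\<bar> powr p)"
    unfolding I_def by (intro integrableI_nonneg) auto
  have val: "(\<integral>z. \<bar>fst z - snd z\<bar> powr p \<partial>Q) = enn2real I"
    unfolding I_def by (intro integral_eq_nn_integral) auto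
  have "ennreal (enn2real I powr (1 / p)) < ennreal \<delta>"
    using less fin by (simp add: ennreal_powr_def I_def[symmetric])
  then have "enn2real I powr (1 / p) \<le> \<delta>"
    by (simp add: ennreal_less_iff)
  then have "(enn2real I powr (1 / p)) powr p \<le> \<delta> powr p"
    using assms by (intro powr_mono2) auto
  then have "enn2real I \<le> \<delta> powr p" using assms by (simp add: powr_powr)
  then show ?thesis using that[OF Q int] val by simp
qed

lemma wasserstein_ball_finite_moment:
  assumes "1 < p" "0 \<le> \<epsilon>" "G0 \<in> finite_moment_distributions p" "G \<in> wasserstein_ball p G0 \<epsilon>"
  shows "G \<in> finite_moment_distributions p"
proof -
  obtain Q where Q: "Q \<in> couplings G G0" "integrable Q (\<lambda>z. \<bar>fst z - snd z\<bar> powr p)"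
    using wasserstein_ball_coupling[OF assms(1,2) _ assms(4), of "\<epsilon> + 1"] by auto
  note c = couplings_props[OF Q(1)]
  note [measurable] = c(2,3)
  have "integrable (distr Q borel snd) (\<lambda>x. \<bar>x\<bar> powr p)"
    unfolding c(5) using assms(3) by (simp add: finite_moment_distributions_def)
  then have "integrable Q (\<lambda>z. \<bar>snd z\<bar> powr p)" by (simp add: integrable_distr_eq)
  moreover have "0 < p" using assms(1) by simp
  ultimately have "integrable Q (\<lambda>z. \<bar>(fst z - snd z) + snd z\<bar> powr p)"
    using integrable_abs_powr_add[OF _ Q(2), where Y=snd] by simp
  then have "integrable (distr Q borel fst) (\<lambda>x. \<bar>x\<bar> powr p)"
    by (simp add: integrable_distr_eq)
  then show ?thesis
    using assms(4) by (simp add: c(4) finite_moment_distributions_def wasserstein_ball_def)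
qed


section \<open>The worst-case pinball risk\<close>

text \<open>The optimal multiplier of \<open>G\<close>, read along a coupling, is feasible for \<open>G0\<close>.\<close>
lemma pinball_risk_ball_upper:
  assumes pAB: "1 < p" "0 < A" "0 < B" and "0 \<le> \<epsilon>" "G0 \<in> finite_moment_distributions p"
    "G \<in> wasserstein_ball p G0 \<epsilon>"
  shows "loss_risk (pinball A B) G \<le> loss_risk (pinball A B) G0 + ereal (sensitivity p A B * \<epsilon>)"
proof -
  have G: "G \<in> finite_moment_distributions p"
    using wasserstein_ball_finite_moment[OF pAB(1) assms(4-6)] .
  obtain s z where z: "z \<in> borel_measurable borel" "\<And>x::real. - B \<le> z x" "\<And>x. z x \<le> A"
    "(\<integral>x. z x \<partial>G) = 0" "(\<integral>x. pinball A B (x - s) \<partial>G) = (\<integral>x. x * z x \<partial>G)"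
    and r: "loss_risk (pinball A B) G = ereal (\<integral>x. x * z x \<partial>G)"
    by (rule pinball_risk_multiplier[OF pAB G]) (rule that; assumption)
  obtain r0 where r0: "loss_risk (pinball A B) G0 = ereal r0"
    by (rule pinball_risk_multiplier[OF pAB assms(5)])
  note [measurable] = z(1)
  \<comment> \<open>The infimum over couplings need not be attained, hence the slightly larger radius \<open>\<delta>\<close>.\<close>
  have "(\<integral>x. x * z x \<partial>G) \<le> r0 + sensitivity p A B * \<delta>" if \<delta>: "\<epsilon> < \<delta>" for \<delta>
  proof -
    obtain Q where Q: "Q \<in> couplings G G0" "integrable Q (\<lambda>z. \<bar>fst z - snd z\<bar> powr p)"
      "(\<integral>z. \<bar>fst z - snd z\<bar> powr p \<partial>Q) \<le> \<delta> powr p"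
      using wasserstein_ball_coupling[OF pAB(1) assms(4) \<delta> assms(6)] .
    note c = couplings_props[OF Q(1)]
    note [measurable] = c(2,3)
    interpret Q: prob_space Q by (rule c(1))
    define \<kappa> where "\<kappa> = optimal_scale p A B \<delta>"
    have \<kappa>: "0 < \<kappa>" "\<kappa> * dual_moment p A B = sensitivity p A B * \<delta>"
      "\<kappa> powr p * dual_moment p A B = \<delta> powr p"
      using optimal_scale[OF pAB, of \<delta>] \<delta> assms(4) dual_moment_pos[OF pAB(2,3), of p]
      by (auto simp: \<kappa>_def optimal_scale_def)
    have "(\<integral>x. z x \<partial>distr Q borel fst) = 0" unfolding c(4) by (rule z(4))
    then have zQ: "(\<integral>w. z (fst w) \<partial>Q) = 0" by (simp add: integral_distr)
    have "integrable (distr Q borel fst) (\<lambda>x. x)" "integrable (distr Q borel snd) (\<lambda>x. x)"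
      unfolding c(4,5)
      by (rule finite_moment_integrable[OF pAB(1) G] finite_moment_integrable[OF pAB(1) assms(5)])+
    then have X: "integrable Q fst" and Y: "integrable Q snd"
      using integrable_distr[OF c(2)] integrable_distr[OF c(3)] by blast+
    have zm: "(\<lambda>w. z (fst w)) \<in> borel_measurable Q" by measurable
    note Xz = Q.integrable_mult_bounded[OF X zm z(2,3)] and Yz = Q.integrable_mult_bounded[OF Y zm z(2,3)]
    have gap: "0 \<le> (\<integral>w. pairing_gap p A B \<kappa> (fst w - snd w) (z (fst w)) \<partial>Q)"
      using pairing_gap_nonneg[OF pAB \<kappa>(1) z(2,3)] by (intro Bochner_Integration.integral_nonneg)
    have "(\<integral>w. (fst w - snd w) * z (fst w) \<partial>Q) \<le> sensitivity p A B * \<delta>"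
      using Q.pairing_le(2)[OF pAB \<kappa>(1) _ zm Q(2) z(2,3) zQ] gap Q(3) \<kappa> by simp
    moreover have "ereal (\<integral>w. snd w * z (fst w) \<partial>Q) \<le> ereal r0"
      using Q.pinball_risk_ge[OF Y zm z(2,3) zQ] by (simp add: c(5) r0)
    moreover have "(\<integral>x. x * z x \<partial>G) = (\<integral>w. fst w * z (fst w) \<partial>Q)"
      unfolding c(4)[symmetric] by (simp add: integral_distr)
    moreover have "(\<integral>w. (fst w - snd w) * z (fst w) \<partial>Q)
        = (\<integral>w. fst w * z (fst w) \<partial>Q) - (\<integral>w. snd w * z (fst w) \<partial>Q)"
      using Xz Yz by (simp add: left_diff_distrib)
    ultimately show ?thesis by simp
  qed
  then have "((\<integral>x. x * z x \<partial>G) - r0) / sensitivity p A B \<le> \<delta>" if "\<epsilon> < \<delta>" for \<delta>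
    using that sensitivity_pos[OF pAB(2,3), of p] by (fastforce simp: pos_divide_le_eq algebra_simps)
  then have "((\<integral>x. x * z x \<partial>G) - r0) / sensitivity p A B \<le> \<epsilon>" by (rule dense_ge)
  then show ?thesis
    using sensitivity_pos[OF pAB(2,3), of p] by (simp add: r r0 pos_divide_le_eq algebra_simps)
qed

lemma unit_interval_two_valued:
  fixes c d \<theta> :: real
  assumes "0 < \<theta>" "\<theta> < 1"
  defines "\<Omega> \<equiv> restrict_space lborel {0<..<1::real}"
  shows "integrable \<Omega> (\<lambda>u. if \<theta> < u then c else d)"
    and "(\<integral>u. (if \<theta> < u then c else d) \<partial>\<Omega>) = c * (1 - \<theta>) + d * \<theta>"
proof -
  interpret prob_space \<Omega>
    by (auto simp: \<Omega>_def emeasure_restrict_space space_restrict_space intro!: prob_spaceI)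
  have S: "{..\<theta>} \<inter> {0<..<1} = {0<..\<theta>}" using assms by auto
  have m: "{0<..\<theta>} \<in> sets \<Omega>" using assms by (auto simp: \<Omega>_def sets_restrict_space_iff)
  have meas: "measure \<Omega> {0<..\<theta>} = \<theta>"
    unfolding \<Omega>_def using assms by (subst measure_restrict_space) auto
  have eq: "(if \<theta> < u then c else d) = c + (d - c) * indicator {0<..\<theta>} u" if "u \<in> space \<Omega>" for u
    using that by (auto simp: \<Omega>_def space_restrict_space)
  have int: "integrable \<Omega> (indicat_real {0<..\<theta>})"
    using m by (intro integrable_const_bound[of _ 1]) auto
  have "integrable \<Omega> (\<lambda>u. c + (d - c) * indicat_real {0<..\<theta>} u)" using int by simp
  then show "integrable \<Omega> (\<lambda>u. if \<theta> < u then c else d)"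
    using eq by (simp cong: Bochner_Integration.integrable_cong)
  have "(\<integral>u. (if \<theta> < u then c else d) \<partial>\<Omega>) = (\<integral>u. c + (d - c) * indicat_real {0<..\<theta>} u \<partial>\<Omega>)"
    using eq by (intro Bochner_Integration.integral_cong) auto
  also have "\<dots> = c + (d - c) * \<theta>"
    using int m meas by (simp add: prob_space)
  finally show "(\<integral>u. (if \<theta> < u then c else d) \<partial>\<Omega>) = c * (1 - \<theta>) + d * \<theta>"
    by (simp add: algebra_simps)
qed

text \<open>The bound is attained: the quantile representation provides a multiplier that takes only the
  values \<open>A\<close> and \<open>- B\<close>, even when \<open>G0\<close> has an atom at the quantile, because the atom is split in the
  unit interval.\<close>
lemma pinball_risk_ball_lower:
  assumes pAB: "1 < p" "0 < A" "0 < B" and "0 \<le> \<epsilon>" and G0: "G0 \<in> finite_moment_distributions p"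
  obtains G where "G \<in> wasserstein_ball p G0 \<epsilon>"
    "loss_risk (pinball A B) G0 + ereal (sensitivity p A B * \<epsilon>) \<le> loss_risk (pinball A B) G"
proof -
  interpret cdf_distribution G0
    using finite_moment_real_distribution[OF G0] by (simp add: cdf_distribution_def)
  define \<Omega> where "\<Omega> = restrict_space lborel {0<..<1::real}"
  interpret \<Omega>: prob_space \<Omega>
    by (auto simp: \<Omega>_def emeasure_restrict_space space_restrict_space intro!: prob_spaceI)
  have I[measurable]: "I \<in> borel_measurable \<Omega>"
    using measurable_CI by (simp add: \<Omega>_def cong: measurable_cong_sets sets_restrict_space_cong)
  have law: "distr \<Omega> borel I = G0" unfolding \<Omega>_def by (rule distr_I_eq_M)
  define \<theta> where "\<theta> = A / (A + B)"
  have \<theta>: "0 < \<theta>" "\<theta> < 1" and \<theta>': "1 - \<theta> = B / (A + B)" using pAB by (auto simp: \<theta>_def field_simps)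
  define a where "a = A powr (1 / (p - 1))"
  define b where "b = B powr (1 / (p - 1))"
  define \<kappa> where "\<kappa> = optimal_scale p A B \<epsilon>"
  have \<kappa>: "0 \<le> \<kappa>" using assms dual_moment_pos[OF pAB(2,3), of p] by (simp add: \<kappa>_def optimal_scale_def)
  define Z where "Z u = (if \<theta> < u then A else - B)" for u
  define H where "H u = (if \<theta> < u then a else - b)" for u
  \<comment> \<open>\<open>I\<close> is the quantile function of \<open>G0\<close>, so \<open>I\<close> has law \<open>G0\<close>, and \<open>Z\<close> is the multiplier that takes
    only the extreme values.  The direction \<open>H\<close> is \<open>sgn Z * \<bar>Z\<bar> powr (1 / (p - 1))\<close>, where Hoelder's
    inequality for \<open>H * Z\<close> is an equality.\<close>
  define X where "X u = I u + \<kappa> * H u" for u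
  note two = unit_interval_two_valued[OF \<theta>, folded \<Omega>_def]
  have Zm[measurable]: "Z \<in> borel_measurable \<Omega>" and Hm[measurable]: "H \<in> borel_measurable \<Omega>"
    unfolding Z_def H_def using two(1) by (auto dest: borel_measurable_integrable)
  have Xm[measurable]: "X \<in> borel_measurable \<Omega>" unfolding X_def by measurable
  have Zb: "- B \<le> Z u" "Z u \<le> A" for u using pAB by (auto simp: Z_def)
  have EZ: "\<Omega>.expectation Z = 0" unfolding Z_def two(2) \<theta>' by (simp add: \<theta>_def)
  have V: "A * a * (1 - \<theta>) + B * b * \<theta> = dual_moment p A B"
    unfolding \<theta>' dual_moment_def a_def[symmetric] b_def[symmetric] unfolding \<theta>_def
    by (simp add: distrib_left add_divide_distrib mult.commute mult.left_commute)
  have HZ: "H u * Z u = (if \<theta> < u then A * a else B * b)" for u by (simp add: H_def Z_def)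
  have Hp: "\<bar>H u\<bar> powr p = (if \<theta> < u then A * a else B * b)" for u
    using powr_conjugate pAB by (simp add: H_def a_def b_def)
  have intI: "integrable \<Omega> I"
  proof -
    have "integrable (distr \<Omega> borel I) (\<lambda>x. x)"
      unfolding law by (rule finite_moment_integrable[OF pAB(1) G0])
    then show ?thesis by (simp add: integrable_distr_eq)
  qed
  have intH: "integrable \<Omega> H" unfolding H_def by (rule two)
  have intX: "integrable \<Omega> X" unfolding X_def using intI intH by simp
  note IZ = \<Omega>.integrable_mult_bounded[OF intI Zm Zb]
  have "loss_risk (pinball A B) G0 \<le> ereal (\<integral>x. pinball A B (x - I \<theta>) \<partial>G0)"
    by (intro loss_risk_le_expectation integrable_pinball finite_moment_integrable[OF pAB(1) G0])
  also have "(\<integral>x. pinball A B (x - I \<theta>) \<partial>G0) = (\<integral>u. pinball A B (I u - I \<theta>) \<partial>\<Omega>)"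
    using integral_distr[OF I, of "\<lambda>x. pinball A B (x - I \<theta>)"] by (simp add: law)
  also have "\<dots> = (\<integral>u. (I u - I \<theta>) * Z u \<partial>\<Omega>)"
  \<comment> \<open>By monotonicity \<open>I\<close> is at least \<open>I \<theta>\<close> where \<open>Z\<close> is \<open>A\<close> and at most \<open>I \<theta>\<close> where \<open>Z\<close> is \<open>- B\<close>.\<close>
  proof (rule Bochner_Integration.integral_cong[OF refl])
    fix u assume "u \<in> space \<Omega>"
    then have u: "u \<in> {0<..<1}" by (simp add: \<Omega>_def space_restrict_space)
    have "\<theta> < u \<Longrightarrow> I \<theta> \<le> I u" "\<not> \<theta> < u \<Longrightarrow> I u \<le> I \<theta>"
      using mono_I u \<theta> by (auto simp: mono_on_def)
    then show "pinball A B (I u - I \<theta>) = (I u - I \<theta>) * Z u"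
      using pinball_of_nonneg[OF pAB(2,3), of "I u - I \<theta>"]
        pinball_of_nonpos[OF pAB(2,3), of "I u - I \<theta>"]
      by (auto simp: Z_def)
  qed
  also have "\<dots> = (\<integral>u. I u * Z u \<partial>\<Omega>)"
    using IZ EZ by (simp add: left_diff_distrib)
  finally have low: "loss_risk (pinball A B) G0 \<le> ereal (\<integral>u. I u * Z u \<partial>\<Omega>)" .
  have "(\<integral>u. X u * Z u \<partial>\<Omega>) = (\<integral>u. I u * Z u + \<kappa> * (if \<theta> < u then A * a else B * b) \<partial>\<Omega>)"
    by (simp add: X_def distrib_right HZ mult.assoc)
  also have "\<dots> = (\<integral>u. I u * Z u \<partial>\<Omega>) + \<kappa> * dual_moment p A B"
    using IZ two(1)[of "A * a" "B * b"] by (simp add: two(2) V del: integral_mult_right_zero)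
  also have "\<kappa> * dual_moment p A B = sensitivity p A B * \<epsilon>"
    unfolding \<kappa>_def by (rule optimal_scale(1)[OF pAB])
  finally have "ereal (\<integral>u. I u * Z u \<partial>\<Omega>) + ereal (sensitivity p A B * \<epsilon>)
      \<le> loss_risk (pinball A B) (distr \<Omega> borel X)"
    using \<Omega>.pinball_risk_ge[OF intX Zm Zb EZ] by simp
  then have risk: "loss_risk (pinball A B) G0 + ereal (sensitivity p A B * \<epsilon>)
      \<le> loss_risk (pinball A B) (distr \<Omega> borel X)"
    using add_right_mono[OF low] by (rule order_trans[rotated])
  define Q where "Q = distr \<Omega> (borel \<Otimes>\<^sub>M borel) (\<lambda>u. (X u, I u))"
  have Q: "Q \<in> couplings (distr \<Omega> borel X) G0"
    unfolding couplings_def Q_def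
    by (auto intro!: \<Omega>.prob_space_distr simp: distr_distr comp_def law)
  have "(\<integral>\<^sup>+ z. ennreal (\<bar>fst z - snd z\<bar> powr p) \<partial>Q) = (\<integral>\<^sup>+ u. ennreal (\<kappa> powr p * \<bar>H u\<bar> powr p) \<partial>\<Omega>)"
    unfolding Q_def using \<kappa>
    by (subst nn_integral_distr) (auto simp: X_def abs_mult powr_mult)
  also have "\<dots> = ennreal (\<integral>u. \<kappa> powr p * \<bar>H u\<bar> powr p \<partial>\<Omega>)"
    using two(1) by (intro nn_integral_eq_integral AE_I2) (simp_all add: Hp, simp add: a_def b_def pAB less_imp_le)
  also have "(\<integral>u. \<kappa> powr p * \<bar>H u\<bar> powr p \<partial>\<Omega>) = \<epsilon> powr p"
    using optimal_scale(2)[OF pAB assms(4)] by (simp add: Hp two(2) V \<kappa>_def)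
  finally have cost: "(\<integral>\<^sup>+ z. ennreal (\<bar>fst z - snd z\<bar> powr p) \<partial>Q) = ennreal (\<epsilon> powr p)" .
  have "wasserstein p (distr \<Omega> borel X) G0
      \<le> ennreal_powr (\<integral>\<^sup>+ z. ennreal (\<bar>fst z - snd z\<bar> powr p) \<partial>Q) (1 / p)"
    unfolding wasserstein_def using Q by (rule INF_lower)
  also have "\<dots> = ennreal \<epsilon>"
    unfolding cost using assms(1,4) by (simp add: ennreal_powr_def powr_powr)
  finally have "distr \<Omega> borel X \<in> wasserstein_ball p G0 \<epsilon>"
    by (simp add: wasserstein_ball_def \<Omega>.real_distribution_distr)
  then show ?thesis using that risk by blast
qed

lemma pinball_risk_ball_SUP:
  assumes "1 < p" "0 < A" "0 < B" "0 \<le> \<epsilon>" "G0 \<in> finite_moment_distributions p"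
  shows "(SUP G\<in>wasserstein_ball p G0 \<epsilon>. loss_risk (pinball A B) G)
    = loss_risk (pinball A B) G0 + ereal (sensitivity p A B * \<epsilon>)"
proof (rule antisym)
  show "(SUP G\<in>wasserstein_ball p G0 \<epsilon>. loss_risk (pinball A B) G)
    \<le> loss_risk (pinball A B) G0 + ereal (sensitivity p A B * \<epsilon>)"
    using pinball_risk_ball_upper[OF assms] by (rule SUP_least)
  show "loss_risk (pinball A B) G0 + ereal (sensitivity p A B * \<epsilon>)
    \<le> (SUP G\<in>wasserstein_ball p G0 \<epsilon>. loss_risk (pinball A B) G)"
    using pinball_risk_ball_lower[OF assms] by (metis SUP_upper2)
qed

lemma loss_risk_shifted_pinball:
  assumes pAB: "1 < p" "0 < A" "0 < B" and G: "G \<in> finite_moment_distributions p"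
    and l: "\<And>x. l x = pinball A B (x - b) + d"
  shows "loss_risk l G = loss_risk (pinball A B) G + ereal d"
proof -
  interpret real_distribution G using G by (rule finite_moment_real_distribution)
  have int: "integrable G (\<lambda>x. pinball A B (x - s))" for s
    by (rule integrable_pinball[OF finite_moment_integrable[OF pAB(1) G]])
  have intl: "integrable G (\<lambda>x. l (x - s))" for s
    using int[of "s + b"] by (simp add: l algebra_simps)
  have El: "(\<integral>x. l (x - s) \<partial>G) = (\<integral>x. pinball A B (x - (s + b)) \<partial>G) + d" for s
    using int[of "s + b"] prob_space by (simp add: l diff_diff_eq)
  obtain r s where r: "loss_risk (pinball A B) G = ereal r" "(\<integral>x. pinball A B (x - s) \<partial>G) = r"
    by (rule pinball_risk_multiplier[OF pAB G]) (rule that; assumption)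
  have "loss_risk l G \<le> ereal (r + d)"
    using loss_risk_le_expectation[where l=l and s="s - b", OF intl] r(2) by (simp add: El)
  moreover have "ereal (r + d) \<le> loss_risk l G"
    unfolding loss_risk_def[of l]
  proof (rule INF_greatest)
    fix s
    have "ereal r \<le> ereal (\<integral>x. pinball A B (x - (s + b)) \<partial>G)"
      using loss_risk_le_expectation[where l="pinball A B", OF int] by (simp add: r(1))
    then show "ereal (r + d) \<le> ext_expectation G (\<lambda>x. l (x - s))"
      by (simp add: ext_expectation_eq_integral[OF intl] El)
  qed
  ultimately show ?thesis by (simp add: r(1))
qed


section \<open>Balls around the Dirac measure\<close>

abbreviation dirac0 :: "real measure" where
  "dirac0 \<equiv> return borel 0"

lemma dirac0_finite_moment: "dirac0 \<in> finite_moment_distributions p"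
proof -
  interpret prob_space dirac0 by (rule prob_space_return) simp
  have "real_distribution dirac0" by (intro real_distribution.intro) (unfold_locales, auto simp: real_distribution_axioms_def)
  moreover have "integrable dirac0 (\<lambda>x. \<bar>x\<bar> powr p)"
    by (rule integrable_const_bound[of _ "\<bar>0\<bar> powr p"]) (auto simp: AE_return)
  ultimately show ?thesis by (simp add: finite_moment_distributions_def)
qed

text \<open>Every coupling with the Dirac measure at \<open>0\<close> has the \<open>p\<close>-th absolute moment of \<open>G\<close> as its cost.\<close>
lemma wasserstein_ball_dirac0_moment:
  assumes "1 < p" "0 \<le> \<epsilon>" "G \<in> wasserstein_ball p dirac0 \<epsilon>"
  shows "(\<integral>x. \<bar>x\<bar> powr p \<partial>G) \<le> \<epsilon> powr p"
proof -
  have "(\<integral>x. \<bar>x\<bar> powr p \<partial>G) powr (1 / p) \<le> \<delta>" if \<delta>: "\<epsilon> < \<delta>" for \<delta>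
  proof -
    obtain Q where Q: "Q \<in> couplings G dirac0"
      "(\<integral>z. \<bar>fst z - snd z\<bar> powr p \<partial>Q) \<le> \<delta> powr p"
      by (rule wasserstein_ball_coupling[OF assms(1,2) \<delta> assms(3)])
    note c = couplings_props[OF Q(1)]
    note [measurable] = c(2,3)
    have "AE y in distr Q borel snd. y = 0" unfolding c(5) by (simp add: AE_return)
    then have "AE z in Q. snd z = 0" by (simp add: AE_distr_iff)
    then have "(\<integral>z. \<bar>fst z - snd z\<bar> powr p \<partial>Q) = (\<integral>z. \<bar>fst z\<bar> powr p \<partial>Q)"
      by (intro integral_cong_AE) auto
    also have "\<dots> = (\<integral>x. \<bar>x\<bar> powr p \<partial>distr Q borel fst)"
      by (simp add: integral_distr)
    also have "distr Q borel fst = G" by (rule c(4))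
    finally have "(\<integral>x. \<bar>x\<bar> powr p \<partial>G) \<le> \<delta> powr p" using Q(2) by simp
    then have "(\<integral>x. \<bar>x\<bar> powr p \<partial>G) powr (1 / p) \<le> (\<delta> powr p) powr (1 / p)"
      using assms by (intro powr_mono2) auto
    then show ?thesis using assms \<delta> by (simp add: powr_powr)
  qed
  then have "(\<integral>x. \<bar>x\<bar> powr p \<partial>G) powr (1 / p) \<le> \<epsilon>" by (rule dense_ge)
  then have "((\<integral>x. \<bar>x\<bar> powr p \<partial>G) powr (1 / p)) powr p \<le> \<epsilon> powr p"
    using assms by (intro powr_mono2) auto
  then show ?thesis using assms by (simp add: powr_powr)
qed

lemma loss_risk_dirac0:
  assumes "l \<in> borel_measurable borel"
  shows "loss_risk l dirac0 = (INF s. ereal (l s))"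
proof -
  interpret prob_space dirac0 by (rule prob_space_return) simp
  have "ext_expectation dirac0 (\<lambda>x. l (x - s)) = ereal (l (- s))" for s
  proof -
    have m: "(\<lambda>x. l (x - s)) \<in> borel_measurable borel" using assms by measurable
    have "integrable dirac0 (\<lambda>x. l (x - s))"
      using m by (intro integrable_const_bound[of _ "\<bar>l (- s)\<bar>"]) (auto simp: AE_return)
    then show ?thesis
      using m by (simp add: ext_expectation_eq_integral integral_return)
  qed
  then have "loss_risk l dirac0 = (INF s. ereal (l (- s)))" by (simp add: loss_risk_def)
  also have "\<dots> = (INF s. ereal (l s))"
  proof (rule INF_eq)
    show "\<exists>j\<in>UNIV. ereal (l j) \<le> ereal (l (- s))" for s by blast
    show "\<exists>j\<in>UNIV. ereal (l (- j)) \<le> ereal (l s)" for s by (rule bexI[of _ "- s"]) auto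
  qed
  finally show ?thesis .
qed


section \<open>Asymptotic slopes of the loss\<close>

lemma convex_borel_measurable:
  fixes l :: "real \<Rightarrow> real"
  assumes "convex_on UNIV l"
  shows "l \<in> borel_measurable borel"
  by (intro borel_measurable_continuous_onI convex_on_continuous open_UNIV assms)

text \<open>The slopes of affine minorants; for a convex loss their supremum and infimum are the asymptotic
  slopes.\<close>
definition slopes :: "(real \<Rightarrow> real) \<Rightarrow> real set" where
  "slopes l = {m. \<exists>k. \<forall>x. m * x + k \<le> l x}"

lemma subgradient_in_slopes:
  assumes "convex_on UNIV l"
  obtains m where "m \<in> slopes l" "\<And>y. l x + m * (y - x) \<le> l y"
proof -
  obtain m where m: "\<And>y. l x + m * (y - x) \<le> l y"
    using convex_le_Inf_differential[OF assms, of x] by auto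
  have "m * y + (l x - m * x) \<le> l y" for y using m[of y] by (simp add: algebra_simps)
  then have "m \<in> slopes l" unfolding slopes_def by blast
  then show ?thesis using that m by blast
qed

lemma pinball_minorant_of_slopes:
  assumes "A \<in> slopes l" "- B \<in> slopes l"
  obtains K where "\<And>x. pinball A B x - K \<le> l x"
proof -
  obtain k1 k2 where k: "\<And>x. A * x + k1 \<le> l x" "\<And>x. - B * x + k2 \<le> l x"
    using assms unfolding slopes_def by blast
  have "pinball A B x - (\<bar>k1\<bar> + \<bar>k2\<bar>) \<le> l x" for x
    using k[of x] by (auto simp: pinball_def max_def)
  then show ?thesis by (rule that)
qed

lemma ext_expectation_mono:
  assumes "\<And>x. f x \<le> g x"
  shows "ext_expectation G f \<le> ext_expectation G g"
  unfolding ext_expectation_def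
  using assms by (intro ereal_minus_mono) (auto simp: less_eq_ennreal.rep_eq[symmetric] intro!: nn_integral_mono ennreal_leI)

lemma loss_risk_ge_pinball:
  assumes "1 < p" "0 < A" "0 < B" "G \<in> finite_moment_distributions p"
    and "\<And>x. pinball A B x - K \<le> l x"
  shows "loss_risk (pinball A B) G - ereal K \<le> loss_risk l G"
proof -
  interpret real_distribution G using assms(4) by (rule finite_moment_real_distribution)
  have "loss_risk (pinball A B) G - ereal K \<le> ext_expectation G (\<lambda>x. l (x - s))" for s
  proof -
    have int: "integrable G (\<lambda>x. pinball A B (x - s))"
      by (rule integrable_pinball[OF finite_moment_integrable[OF assms(1,4)]])
    have "loss_risk (pinball A B) G - ereal K \<le> ereal (\<integral>x. pinball A B (x - s) \<partial>G) - ereal K"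
      by (intro ereal_minus_mono loss_risk_le_expectation int) simp
    also have "\<dots> = ext_expectation G (\<lambda>x. pinball A B (x - s) - K)"
      using int prob_space by (subst ext_expectation_eq_integral) auto
    also have "\<dots> \<le> ext_expectation G (\<lambda>x. l (x - s))"
      using assms(5) by (rule ext_expectation_mono)
    finally show ?thesis .
  qed
  then show ?thesis unfolding loss_risk_def[of l] by (rule INF_greatest)
qed

text \<open>For large radii the additive constants are negligible against the linear growth of the risks.\<close>
lemma sensitivity_le_of_minorant:
  assumes pAB: "1 < p" "0 < A" "0 < B" and minorant: "\<And>x. pinball A B x - K \<le> l x"
    and bound: "\<And>\<epsilon> G. 0 \<le> \<epsilon> \<Longrightarrow> G \<in> wasserstein_ball p dirac0 \<epsilon> \<Longrightarrow> loss_risk l G \<le> ereal (d + c * \<epsilon>)"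
  shows "sensitivity p A B \<le> c"
proof (rule ccontr)
  assume "\<not> sensitivity p A B \<le> c"
  then have pos: "0 < sensitivity p A B - c" by simp
  obtain r where r: "loss_risk (pinball A B) dirac0 = ereal r"
    by (rule pinball_risk_multiplier[OF pAB dirac0_finite_moment])
  have *: "r + sensitivity p A B * \<epsilon> \<le> K + d + c * \<epsilon>" if \<epsilon>: "0 \<le> \<epsilon>" for \<epsilon>
  proof -
    obtain G where G: "G \<in> wasserstein_ball p dirac0 \<epsilon>"
      "ereal (r + sensitivity p A B * \<epsilon>) \<le> loss_risk (pinball A B) G"
      using pinball_risk_ball_lower[OF pAB \<epsilon> dirac0_finite_moment] by (metis r plus_ereal.simps(1))
    have "G \<in> finite_moment_distributions p"
      by (rule wasserstein_ball_finite_moment[OF pAB(1) \<epsilon> dirac0_finite_moment G(1)])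
    from loss_risk_ge_pinball[OF pAB this minorant]
    have "ereal (r + sensitivity p A B * \<epsilon>) - ereal K \<le> ereal (d + c * \<epsilon>)"
      using G(2) bound[OF \<epsilon> G(1)] by (meson ereal_minus_mono order.refl order_trans)
    then show ?thesis by simp
  qed
  \<comment> \<open>A radius for which the difference of the linear terms exceeds all constants.\<close>
  define \<epsilon> where "\<epsilon> = (\<bar>K + d - r\<bar> + 1) / (sensitivity p A B - c)"
  have "(sensitivity p A B - c) * \<epsilon> = \<bar>K + d - r\<bar> + 1" using pos by (simp add: \<epsilon>_def)
  moreover have "0 \<le> \<epsilon>" using pos by (simp add: \<epsilon>_def)
  ultimately show False using *[of \<epsilon>] by (simp add: left_diff_distrib)
qed

text \<open>For \<open>A \<ge> B\<close> the dual moment is at least \<open>B / 2 * A powr (1 / (p - 1))\<close>, which is unbounded in \<open>A\<close>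
  because \<open>p\<close> is finite.\<close>
lemma slope_le_of_sensitivity_le:
  assumes pAB: "1 < p" "0 < A" "0 < B" and "sensitivity p A B \<le> c"
  shows "A \<le> max B ((2 / B * c powr (p / (p - 1))) powr (p - 1))"
proof (cases "A \<le> B")
  case False
  define a where "a = A powr (1 / (p - 1))"
  define b where "b = B powr (1 / (p - 1))"
  define V where "V = dual_moment p A B"
  have ab: "0 < a" "0 < b" "0 < V" using pAB dual_moment_pos[OF pAB(2,3)] by (auto simp: a_def b_def V_def)
  have "B * a / 2 = A * B * a / (2 * A)" using pAB by simp
  also have "\<dots> \<le> A * B * (a + b) / (A + B)"
    using pAB ab False by (intro frac_le mult_left_mono) auto
  also have "\<dots> = V" by (simp add: V_def dual_moment_def a_def b_def)
  also have "V = sensitivity p A B powr (p / (p - 1))"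
  proof -
    have "(1 - 1 / p) * (p / (p - 1)) = 1" using pAB by (simp add: field_simps)
    then show ?thesis
      using ab(3) unfolding sensitivity_def V_def[symmetric] powr_powr by (simp only: powr_one)
  qed
  also have "\<dots> \<le> c powr (p / (p - 1))"
    using assms sensitivity_pos[OF pAB(2,3), of p] by (intro powr_mono2) auto
  finally have "a \<le> 2 / B * c powr (p / (p - 1))" using pAB by (simp add: field_simps)
  then have "a powr (p - 1) \<le> (2 / B * c powr (p / (p - 1))) powr (p - 1)"
    using ab pAB by (intro powr_mono2) auto
  moreover have "a powr (p - 1) = A" using pAB by (simp add: a_def powr_powr)
  ultimately show ?thesis by simp
qed simp

text \<open>Letting the shift drift in the direction in which the loss decreases, the expected loss tends
  to the infimum of the loss by dominated convergence.  A shift with integrable loss, from which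
  the drift starts, exists because the risk is finite.\<close>
lemma loss_risk_le_of_monotone:
  assumes p: "1 < p" and l: "convex_on UNIV l" "l \<in> borel_measurable borel"
    and G: "G \<in> finite_moment_distributions p" and fin: "loss_risk l G \<noteq> \<infinity>"
    and \<sigma>: "\<sigma> = 1 \<or> \<sigma> = - 1" and mono: "\<And>x h. 0 \<le> h \<Longrightarrow> l (x + \<sigma> * h) \<le> l x"
    and d: "\<And>x. d \<le> l x" "\<And>e. d < e \<Longrightarrow> \<exists>x. l x < e"
  shows "loss_risk l G \<le> ereal d"
proof -
  interpret real_distribution G using G by (rule finite_moment_real_distribution)
  note [measurable] = l(2)
  have "\<exists>s. ext_expectation G (\<lambda>x. l (x - s)) < \<infinity>"
    using fin unfolding loss_risk_def less_top[symmetric] top_ereal_def[symmetric] INF_less_iff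
    by (auto simp: less_top)
  then obtain s where s: "ext_expectation G (\<lambda>x. l (x - s)) < \<infinity>" by blast
  have neg: "(\<integral>\<^sup>+ x. ennreal (- l (x - s)) \<partial>G) < \<infinity>"
    using nn_integral_neg_part_finite[OF l(1) _ G] p by simp
  have pos: "(\<integral>\<^sup>+ x. ennreal (l (x - s)) \<partial>G) \<noteq> \<infinity>"
  proof
    assume "(\<integral>\<^sup>+ x. ennreal (l (x - s)) \<partial>G) = \<infinity>"
    then show False using s neg
      by (cases "\<integral>\<^sup>+ x. ennreal (- l (x - s)) \<partial>G")
         (auto simp: ext_expectation_def enn2ereal_ennreal)
  qed
  have int: "integrable G (\<lambda>x. l (x - s))"
    using pos neg by (simp add: real_integrable_def)
  define f where "f n x = l (x - (s - \<sigma> * real n))" for n x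
  have f_le: "f n x \<le> l (x - s)" and f_ge: "d \<le> f n x" for n x
    using mono[of "real n" "x - s"] d(1) by (auto simp: f_def algebra_simps)
  \<comment> \<open>Along the drift the loss falls below its value at any prescribed point \<open>y\<close>.\<close>
  have lim: "(\<lambda>n. f n x) \<longlonglongrightarrow> d" for x
  proof (rule order_tendstoI)
    show "\<forall>\<^sub>F n in sequentially. e < f n x" if "e < d" for e
      using less_le_trans[OF that f_ge] by simp
    fix e assume "d < e"
    then obtain y where y: "l y < e" using d(2) by blast
    obtain N where N: "\<bar>x - s - y\<bar> \<le> real N" using real_arch_simple by blast
    show "\<forall>\<^sub>F n in sequentially. f n x < e"
    proof (rule eventually_sequentiallyI[of N])
      fix n assume "N \<le> n"
      define h where "h = \<sigma> * (x - s - y) + real n"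
      have "0 \<le> h" using N \<open>N \<le> n\<close> \<sigma> by (auto simp: h_def)
      moreover have "x - (s - \<sigma> * real n) = y + \<sigma> * h"
        using \<sigma> by (auto simp: h_def algebra_simps)
      ultimately have "f n x \<le> l y" using mono[of h y] by (simp add: f_def)
      then show "f n x < e" using y by simp
    qed
  qed
  have fm: "f n \<in> borel_measurable G" for n unfolding f_def by measurable
  have w: "integrable G (\<lambda>x. \<bar>l (x - s)\<bar> + \<bar>d\<bar>)" using int by simp
  have bd: "AE x in G. norm (f n x) \<le> \<bar>l (x - s)\<bar> + \<bar>d\<bar>" for n
  proof (rule AE_I2)
    show "norm (f n x) \<le> \<bar>l (x - s)\<bar> + \<bar>d\<bar>" for x
      using f_le[of n x] f_ge[of n x] unfolding real_norm_def by arith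
  qed
  have "(\<lambda>n. \<integral>x. f n x \<partial>G) \<longlonglongrightarrow> (\<integral>x. d \<partial>G)"
    by (rule integral_dominated_convergence[OF _ fm w _ bd]) (use lim in auto)
  then have lim': "(\<lambda>n. ereal (\<integral>x. f n x \<partial>G)) \<longlonglongrightarrow> ereal d"
    using prob_space by simp
  have intf: "integrable G (f n)" for n
    by (rule Bochner_Integration.integrable_bound[OF w fm]) (use bd in \<open>auto elim!: eventually_mono\<close>)
  have "loss_risk l G \<le> ereal (\<integral>x. f n x \<partial>G)" for n
    using loss_risk_le_expectation[of G l "s - \<sigma> * real n"] intf[of n] by (simp add: f_def[abs_def])
  then show ?thesis by (intro LIMSEQ_le_const[OF lim']) auto
qed


section \<open>Losses strictly below a pinball loss\<close>

text \<open>The hypothesis \<open>Lip\<close> at \<open>x0\<close> puts \<open>l\<close> below the pinball loss with the value \<open>l x0\<close> at \<open>x0\<close>.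
  The risk of \<open>G\<close> has two upper bounds: one decreases with the expected pairing gap, the other is near
  the expected loss under the two-point law when that gap is small.  Together they exclude
  risks close to \<open>l x0 + sensitivity p A B * \<epsilon>\<close>.\<close>
lemma strict_gap_loses_risk:
  assumes pAB: "1 < p" "0 < A" "0 < B" and [measurable]: "l \<in> borel_measurable borel"
    and Lip: "\<And>x h. l (x + h) \<le> l x + pinball A B h"
    and gap: "l (x0 + t) < l x0 + pinball A B t"
  obtains \<epsilon> \<delta> where "0 < \<epsilon>" "0 < \<delta>"
    "\<And>G. G \<in> wasserstein_ball p dirac0 \<epsilon> \<Longrightarrow> loss_risk l G \<le> ereal (l x0 + sensitivity p A B * \<epsilon> - \<delta>)"
proof -
  define a where "a = A powr (1 / (p - 1))"
  define b where "b = B powr (1 / (p - 1))"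
  define V where "V = dual_moment p A B"
  define S where "S = A + B"
  have pos: "0 < a" "0 < b" "0 < V" "0 < S"
    using pAB dual_moment_pos[OF pAB(2,3)] by (auto simp: a_def b_def V_def S_def)
  have "t \<noteq> 0" using gap by (auto simp: pinball_def)
  \<comment> \<open>The worst-case law around the Dirac measure sits on \<open>\<kappa> * a\<close> and \<open>- \<kappa> * b\<close>; the scale is chosen
    so that one of these two points is \<open>t\<close>.\<close>
  define \<kappa> where "\<kappa> = (if 0 < t then t / a else - t / b)"
  have \<kappa>: "0 < \<kappa>" using \<open>t \<noteq> 0\<close> pos by (auto simp: \<kappa>_def divide_neg_pos)
  define \<epsilon> where "\<epsilon> = \<kappa> * V powr (1 / p)"
  have \<epsilon>: "0 < \<epsilon>" using \<kappa> pos by (simp add: \<epsilon>_def)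
  have "optimal_scale p A B \<epsilon> = \<kappa>"
    using pos by (simp add: optimal_scale_def \<epsilon>_def V_def[symmetric] powr_minus)
  then have \<kappa>V: "\<kappa> * V = sensitivity p A B * \<epsilon>" and \<kappa>p: "\<kappa> powr p * V = \<epsilon> powr p"
    using optimal_scale[OF pAB, of \<epsilon>] \<epsilon> by (auto simp: V_def)
  define l1 where "l1 = l (x0 + \<kappa> * a)"
  define l2 where "l2 = l (x0 + - (\<kappa> * b))"
  \<comment> \<open>\<open>a0 + b0 * z\<close> is the affine function with value \<open>l1\<close> at \<open>z = A\<close> and \<open>l2\<close> at \<open>z = - B\<close>; its
    expectation is \<open>a0\<close> when \<open>z\<close> is replaced by a centred random variable.\<close>
  define a0 where "a0 = (B * l1 + A * l2) / S"
  define b0 where "b0 = (l1 - l2) / S"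
  have pb: "pinball A B (\<kappa> * a) = \<kappa> * a * A" "pinball A B (- (\<kappa> * b)) = \<kappa> * b * B"
    using \<kappa> pos pAB pinball_of_nonneg[of A B "\<kappa> * a"] pinball_of_nonpos[of A B "- (\<kappa> * b)"] by auto
  have "l1 \<le> l x0 + \<kappa> * a * A" "l2 \<le> l x0 + \<kappa> * b * B"
    using Lip[of x0 "\<kappa> * a"] Lip[of x0 "- (\<kappa> * b)"] by (simp_all add: l1_def l2_def pb)
  moreover have "l1 < l x0 + \<kappa> * a * A \<or> l2 < l x0 + \<kappa> * b * B"
  proof (cases "0 < t")
    case True
    then have "t = \<kappa> * a" using pos by (simp add: \<kappa>_def)
    then show ?thesis using gap pb by (simp add: l1_def)
  next
    case False
    then have "t = - (\<kappa> * b)" using pos by (simp add: \<kappa>_def)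
    then show ?thesis using gap pb by (simp add: l2_def)
  qed
  ultimately have "B * l1 + A * l2 < B * (l x0 + \<kappa> * a * A) + A * (l x0 + \<kappa> * b * B)"
    using pAB by (auto intro: add_less_le_mono add_le_less_mono)
  also have "\<dots> = (l x0 + \<kappa> * V) * S"
    using pos by (simp add: V_def dual_moment_def a_def[symmetric] b_def[symmetric] S_def[symmetric] distrib_right)
      (simp add: S_def algebra_simps)
  finally have "a0 < l x0 + \<kappa> * V" using pos by (simp add: a0_def pos_divide_less_eq)
  define \<mu> where "\<mu> = l x0 + \<kappa> * V - a0"
  have \<mu>: "0 < \<mu>" using \<open>a0 < _\<close> by (simp add: \<mu>_def)
  define \<eta> where "\<eta> = \<mu> / (2 * (S * (\<kappa> * (a + b))))"
  have \<eta>: "0 < \<eta>" "S * (\<kappa> * (a + b)) * \<eta> = \<mu> / 2" using \<mu> pos \<kappa> by (auto simp: \<eta>_def)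
  obtain C where C: "0 \<le> C" "\<And>t. \<bar>t - 1\<bar> \<le> \<eta> + C * young_gap p t"
    by (rule young_gap_controls_distance[OF pAB(1) \<eta>(1)]) (rule that; assumption)
  define K where "K = S * C / min A B"
  have K: "0 \<le> K" "S * C \<le> K * A" "S * C \<le> K * B"
    using C pos pAB by (auto simp: K_def pos_le_divide_eq intro!: mult_left_mono)
  define \<phi> where "\<phi> x z = pairing_gap p A B \<kappa> x z" for x z
  have pin: "pinball A B y \<le> S * \<bar>y\<bar>" for y
  proof (cases "0 \<le> y")
    case True
    then have "y * A \<le> y * S" using pAB by (intro mult_left_mono) (simp_all add: S_def)
    then show ?thesis using pinball_of_nonneg[OF pAB(2,3) True] True by (simp add: mult.commute)
  next
    case False
    then have "- y * B \<le> - y * S" using pAB by (intro mult_left_mono) (simp_all add: S_def)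
    then show ?thesis using pinball_of_nonpos[OF pAB(2,3), of y] False by (simp add: mult.commute)
  qed
  \<comment> \<open>Near the two atoms the loss is controlled by the Lipschitz bound, and far from them the Young
    remainder pays for the distance.\<close>
  have near: "l (x0 + x) \<le> l (x0 + r) + S * (\<kappa> * u) * \<eta> + K * (\<kappa> * D * u * young_gap p (x / r))"
    if "\<bar>r\<bar> = \<kappa> * u" "0 < u" "S * C \<le> K * D" for x r u D
  proof -
    have r: "r \<noteq> 0" using that \<kappa> by auto
    have "l (x0 + x) \<le> l (x0 + r) + S * \<bar>x - r\<bar>"
      using Lip[of "x0 + r" "x - r"] pin[of "x - r"] by simp
    also have "\<bar>x - r\<bar> = \<kappa> * u * \<bar>x / r - 1\<bar>"
      using r that(1) by (simp add: abs_mult[symmetric] that(1)[symmetric] right_diff_distrib)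
    also have "\<dots> \<le> \<kappa> * u * (\<eta> + C * young_gap p (x / r))"
      using C(2) \<kappa> that by (intro mult_left_mono) auto
    finally have "l (x0 + x) \<le> l (x0 + r) + S * (\<kappa> * u * (\<eta> + C * young_gap p (x / r)))"
      using pos by simp
    also have "\<dots> = l (x0 + r) + S * (\<kappa> * u) * \<eta> + (S * C) * (\<kappa> * u * young_gap p (x / r))"
      by (simp add: algebra_simps)
    also have "(S * C) * (\<kappa> * u * young_gap p (x / r)) \<le> (K * D) * (\<kappa> * u * young_gap p (x / r))"
      using that \<kappa> young_gap_nonneg[OF pAB(1)] by (intro mult_right_mono) auto
    finally show ?thesis by (simp add: mult_ac)
  qed
  \<comment> \<open>The right-hand side is affine in \<open>z\<close>, so it is enough to have the bound at \<open>z = A\<close> and \<open>z = - B\<close>.\<close>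
  have pointwise: "l (x0 + x) \<le> a0 + b0 * z + \<mu> / 2 + K * \<phi> x z" if z: "- B \<le> z" "z \<le> A" for x z
  proof -
    define w where "w = (z + B) / S"
    define v where "v = (A - z) / S"
    have w: "0 \<le> w" "0 \<le> v" "w + v = 1"
      using z pos by (auto simp: w_def v_def add_divide_distrib[symmetric]) (simp add: S_def)
    define Y1 where "Y1 = \<kappa> * A * a * young_gap p (x / (\<kappa> * a))"
    define Y2 where "Y2 = \<kappa> * B * b * young_gap p (- x / (\<kappa> * b))"
    have 1: "l (x0 + x) \<le> l1 + S * (\<kappa> * (a + b)) * \<eta> + K * Y1"
    proof -
      have "S * (\<kappa> * a) * \<eta> \<le> S * (\<kappa> * (a + b)) * \<eta>"
        using pos \<kappa> \<eta> by (intro mult_right_mono mult_left_mono) auto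
      moreover have "l (x0 + x) \<le> l1 + S * (\<kappa> * a) * \<eta> + K * Y1"
        using near[of "\<kappa> * a" a A x] \<kappa> pos K by (simp add: l1_def Y1_def)
      ultimately show ?thesis by linarith
    qed
    have 2: "l (x0 + x) \<le> l2 + S * (\<kappa> * (a + b)) * \<eta> + K * Y2"
    proof -
      have "S * (\<kappa> * b) * \<eta> \<le> S * (\<kappa> * (a + b)) * \<eta>"
        using pos \<kappa> \<eta> by (intro mult_right_mono mult_left_mono) auto
      moreover have "l (x0 + x) \<le> l2 + S * (\<kappa> * b) * \<eta> + K * Y2"
        using near[of "- (\<kappa> * b)" b B x] \<kappa> pos K by (simp add: l2_def Y2_def)
      ultimately show ?thesis by linarith
    qed
    have "l (x0 + x) = w * l (x0 + x) + v * l (x0 + x)" using w by (simp flip: distrib_right)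
    also have "\<dots> \<le> w * (l1 + \<mu> / 2 + K * Y1) + v * (l2 + \<mu> / 2 + K * Y2)"
      using 1 2 w unfolding \<eta>(2) by (intro add_mono mult_left_mono) auto
    also have "\<dots> = (w * l1 + v * l2) + (w + v) * (\<mu> / 2) + K * (w * Y1 + v * Y2)"
      by (simp add: algebra_simps)
    also have "w * Y1 + v * Y2 = \<phi> x z"
      by (simp add: \<phi>_def pairing_gap_def w_def v_def Y1_def Y2_def S_def a_def b_def)
    also have "w * l1 + v * l2 = a0 + b0 * z"
      by (simp add: w_def v_def a0_def b0_def flip: add_divide_distrib) (simp add: algebra_simps)
    finally show ?thesis using w by simp
  qed
  \<comment> \<open>This value balances the two upper bounds \<open>l x0 + \<kappa> * V - g\<close> and \<open>a0 + \<mu> / 2 + K * g\<close> for the risk,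
    where \<open>g\<close> is the expected pairing gap.\<close>
  define \<delta> where "\<delta> = \<mu> / (2 * (1 + K))"
  have \<delta>: "0 < \<delta>" "\<delta> + K * \<delta> = \<mu> / 2"
  proof -
    show "0 < \<delta>" using \<mu> K by (simp add: \<delta>_def)
    have "1 + K \<noteq> 0" using K by simp
    then have "(1 + K) * \<delta> = \<mu> / 2" by (simp add: \<delta>_def divide_simps)
    then show "\<delta> + K * \<delta> = \<mu> / 2" by (simp add: distrib_right)
  qed
  show ?thesis
  proof (rule that[OF \<epsilon> \<delta>(1)])
    fix G assume ball: "G \<in> wasserstein_ball p dirac0 \<epsilon>"
    have \<epsilon>0: "0 \<le> \<epsilon>" using \<epsilon> by simp
    have G: "G \<in> finite_moment_distributions p"
      by (rule wasserstein_ball_finite_moment[OF pAB(1) \<epsilon>0 dirac0_finite_moment ball])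
    interpret real_distribution G using G by (rule finite_moment_real_distribution)
    have Xp: "integrable G (\<lambda>x. \<bar>x\<bar> powr p)" using G by (simp add: finite_moment_distributions_def)
    have X: "integrable G (\<lambda>x. x)" by (rule finite_moment_integrable[OF pAB(1) G])
    obtain s z where z: "z \<in> borel_measurable borel" "\<And>x::real. - B \<le> z x" "\<And>x. z x \<le> A"
      "(\<integral>x. z x \<partial>G) = 0" and sz: "(\<integral>x. pinball A B (x - s) \<partial>G) = (\<integral>x. x * z x \<partial>G)"
      by (rule pinball_risk_multiplier[OF pAB G]) (rule that; assumption)
    have zm: "z \<in> borel_measurable G" using z(1) by simp
    have idm: "(\<lambda>x. x) \<in> borel_measurable G" by simp
    have mom: "expectation (\<lambda>x. \<bar>x\<bar> powr p) \<le> \<kappa> powr p * dual_moment p A B"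
      using wasserstein_ball_dirac0_moment[OF pAB(1) \<epsilon>0 ball] \<kappa>p by (simp add: V_def)
    note pair = pairing_le[OF pAB \<kappa> idm zm Xp z(2,3,4) mom, folded \<phi>_def V_def]
    define g where "g = expectation (\<lambda>x. \<phi> x (z x))"
    have intl: "integrable G (\<lambda>x. l (x - r))" for r
    proof (rule Bochner_Integration.integrable_bound)
      show "integrable G (\<lambda>x. \<bar>l 0\<bar> + S * (\<bar>x - r\<bar>))" using X by simp
      have "\<bar>l y\<bar> \<le> \<bar>l 0\<bar> + S * \<bar>y\<bar>" for y
        using Lip[of 0 y] Lip[of y "- y"] pin[of y] pin[of "- y"] by simp
      then show "AE x in G. norm (l (x - r)) \<le> norm (\<bar>l 0\<bar> + S * \<bar>x - r\<bar>)"
        by (intro AE_I2) (auto intro: order_trans[OF _ abs_ge_self])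
    qed simp
    \<comment> \<open>The kink of the pinball majorant is shifted to a quantile of \<open>G\<close>, where duality applies.\<close>
    have "expectation (\<lambda>x. l (x - (s - x0))) \<le> expectation (\<lambda>x. l x0 + pinball A B (x - s))"
    proof (rule integral_mono[OF intl])
      show "integrable G (\<lambda>x. l x0 + pinball A B (x - s))" using integrable_pinball[OF X] by simp
      show "l (x - (s - x0)) \<le> l x0 + pinball A B (x - s)" for x
        using Lip[of x0 "x - s"] by (simp add: algebra_simps)
    qed
    also have "\<dots> = l x0 + expectation (\<lambda>x. x * z x)"
      using integrable_pinball[OF X] prob_space by (simp add: sz)
    also have "\<dots> \<le> l x0 + \<kappa> * V - g" using pair(2) by (simp add: g_def)
    finally have up1: "loss_risk l G \<le> ereal (l x0 + \<kappa> * V - g)"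
      using loss_risk_le_expectation[where l=l and G=G and s="s - x0", OF intl]
      by (meson ereal_less_eq(3) order_trans)
    \<comment> \<open>With the kink at the origin, between the two atoms, the pointwise estimate applies.\<close>
    have "expectation (\<lambda>x. l (x - (- x0))) \<le> expectation (\<lambda>x. a0 + b0 * z x + \<mu> / 2 + K * \<phi> x (z x))"
    proof (rule integral_mono[OF intl])
      show "integrable G (\<lambda>x. a0 + b0 * z x + \<mu> / 2 + K * \<phi> x (z x))"
        using pair(1) integrable_mult_bounded(2)[OF X zm z(2,3)] by simp
      show "l (x - (- x0)) \<le> a0 + b0 * z x + \<mu> / 2 + K * \<phi> x (z x)" for x
        using pointwise[OF z(2,3), of x x] by (simp add: add.commute)
    qed
    also have "\<dots> = a0 + \<mu> / 2 + K * g"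
      using pair(1) integrable_mult_bounded(2)[OF X zm z(2,3)] z(4) prob_space by (simp add: g_def)
    finally have up2: "loss_risk l G \<le> ereal (a0 + \<mu> / 2 + K * g)"
      using loss_risk_le_expectation[where l=l and G=G and s="- x0", OF intl]
      by (meson ereal_less_eq(3) order_trans)
    show "loss_risk l G \<le> ereal (l x0 + sensitivity p A B * \<epsilon> - \<delta>)"
    proof (cases "\<delta> \<le> g")
      case True
      then have "l x0 + \<kappa> * V - g \<le> l x0 + sensitivity p A B * \<epsilon> - \<delta>" using \<kappa>V by simp
      then show ?thesis using up1 by (meson ereal_less_eq(3) order_trans)
    next
      case False
      then have "K * g \<le> K * \<delta>" using K by (intro mult_left_mono) auto
      then have "a0 + \<mu> / 2 + K * g \<le> l x0 + sensitivity p A B * \<epsilon> - \<delta>"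
        using \<kappa>V \<delta>(2) \<mu>_def by linarith
      then show ?thesis using up2 by (meson ereal_less_eq(3) order_trans)
    qed
  qed
qed


section \<open>Characterisation of the check loss\<close>

lemma pinball_of_linear_growth_at_dirac0:
  assumes p: "1 < p" and l: "convex_on UNIV l"
    and fin: "\<forall>G\<in>finite_moment_distributions p. \<bar>loss_risk l G\<bar> \<noteq> \<infinity>"
    and c: "0 < c"
    and eq: "\<And>\<epsilon>. 0 \<le> \<epsilon> \<Longrightarrow>
      (SUP G\<in>wasserstein_ball p dirac0 \<epsilon>. loss_risk l G) = loss_risk l dirac0 + ereal (c * \<epsilon>)"
  shows "\<exists>A B b d. 0 < A \<and> 0 < B \<and> (\<forall>x. l x = pinball A B (x - b) + d)"
proof -
  note lm = convex_borel_measurable[OF l]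
  obtain d where d: "loss_risk l dirac0 = ereal d"
    using fin dirac0_finite_moment[of p] by (cases "loss_risk l dirac0") auto
  then have inf: "(INF s. ereal (l s)) = ereal d" by (simp add: loss_risk_dirac0[OF lm])
  have d_le: "d \<le> l x" for x
    using INF_lower[of x UNIV "\<lambda>s. ereal (l s)"] by (simp add: inf)
  have d_approx: "\<exists>x. l x < e" if "d < e" for e
    using that INF_less_iff[of "\<lambda>s. ereal (l s)" UNIV "ereal e"] by (simp add: inf)
  have bound: "loss_risk l G \<le> ereal (d + c * \<epsilon>)" if "0 \<le> \<epsilon>" "G \<in> wasserstein_ball p dirac0 \<epsilon>" for \<epsilon> G
    using SUP_upper[OF that(2), of "loss_risk l"] eq[OF that(1)] by (simp add: d)

  \<comment> \<open>A monotone loss would have constant risk, contradicting \<open>0 < c\<close>.\<close>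
  have not_monotone: False if \<sigma>: "\<sigma> = 1 \<or> \<sigma> = - 1" and mono: "\<And>x h. 0 \<le> h \<Longrightarrow> l (x + \<sigma> * h) \<le> l x" for \<sigma>
  proof -
    have "loss_risk l G \<le> ereal d" if "G \<in> wasserstein_ball p dirac0 1" for G
    proof -
      have G: "G \<in> finite_moment_distributions p"
        by (rule wasserstein_ball_finite_moment[OF p _ dirac0_finite_moment that]) simp
      then have "loss_risk l G \<noteq> \<infinity>" using fin by force
      then show ?thesis by (rule loss_risk_le_of_monotone[OF p l lm G _ \<sigma> mono d_le d_approx])
    qed
    then have "ereal (d + c) \<le> ereal d" using eq[of 1] by (simp add: d SUP_le_iff flip: plus_ereal.simps(1)) (metis SUP_least)
    then show False using c by simp
  qed
  have slope_pos: "\<exists>m\<in>slopes l. 0 < m"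
  proof (rule ccontr)
    assume none: "\<not> ?thesis"
    have "l (x + 1 * h) \<le> l x" if "0 \<le> h" for x h
    proof -
      obtain m where m: "m \<in> slopes l" "\<And>y. l (x + h) + m * (y - (x + h)) \<le> l y"
        by (rule subgradient_in_slopes[OF l]) (rule that; assumption)
      have "m \<le> 0" using none m(1) by force
      then have "m * h \<le> 0" using that by (rule mult_nonpos_nonneg)
      then show ?thesis using m(2)[of x] by simp
    qed
    then show False using not_monotone[of 1] by blast
  qed
  have slope_neg: "\<exists>m\<in>slopes l. m < 0"
  proof (rule ccontr)
    assume none: "\<not> ?thesis"
    have "l (x + - 1 * h) \<le> l x" if "0 \<le> h" for x h
    proof -
      obtain m where m: "m \<in> slopes l" "\<And>y. l (x - h) + m * (y - (x - h)) \<le> l y"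
        by (rule subgradient_in_slopes[OF l]) (rule that; assumption)
      have "0 \<le> m" using none m(1) by force
      then have "0 \<le> m * h" using that by (rule mult_nonneg_nonneg)
      then show ?thesis using m(2)[of x] by simp
    qed
    then show False using not_monotone[of "- 1"] by blast
  qed
  obtain m1 where m1: "m1 \<in> slopes l" "0 < m1" using slope_pos by blast
  obtain m2 where m2: "m2 \<in> slopes l" "m2 < 0" using slope_neg by blast

  \<comment> \<open>Each pair of slopes of affine minorants bounds \<open>c\<close> from below, and the sensitivity is unbounded
    in the slopes; so the slopes are bounded.\<close>
  have sens: "sensitivity p m m' \<le> c" if mm: "m \<in> slopes l" "0 < m" "- m' \<in> slopes l" "0 < m'" for m m'
  proof -
    obtain K where "\<And>x. pinball m m' x - K \<le> l x"
      using pinball_minorant_of_slopes[OF mm(1,3)] by blast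
    then show ?thesis using sensitivity_le_of_minorant[OF p mm(2,4) _ bound] by blast
  qed
  have bdd: "bdd_above (slopes l)" "bdd_below (slopes l)"
  proof -
    define u where "u B = max B ((2 / B * c powr (p / (p - 1))) powr (p - 1))" for B
    have "m \<le> u (- m2)" if "m \<in> slopes l" for m
    proof (cases "0 < m")
      case True
      have "sensitivity p m (- m2) \<le> c" using sens[of m "- m2"] m2 True that by simp
      then show ?thesis
        using slope_le_of_sensitivity_le[OF p True, of "- m2" c] m2 by (simp add: u_def)
    next
      case False
      then show ?thesis using m2 by (simp add: u_def max_def)
    qed
    then show "bdd_above (slopes l)" by (rule bdd_aboveI)
    have "- u m1 \<le> m" if "m \<in> slopes l" for m
    proof (cases "m < 0")
      case True
      have "sensitivity p (- m) m1 \<le> c"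
        using sens[of m1 "- m"] m1 True that by (simp add: sensitivity_commute)
      then show ?thesis
        using slope_le_of_sensitivity_le[OF p _ m1(2), of "- m" c] True by (simp add: u_def)
    next
      case False
      then show ?thesis using m1 by (simp add: u_def max_def)
    qed
    then show "bdd_below (slopes l)" by (rule bdd_belowI)
  qed
  \<comment> \<open>The asymptotic slopes of \<open>l\<close> at \<open>\<infinity>\<close> and, up to sign, at \<open>- \<infinity>\<close>.\<close>
  define A where "A = Sup (slopes l)"
  define B where "B = - Inf (slopes l)"
  have in_range: "- B \<le> m" "m \<le> A" if "m \<in> slopes l" for m
    using that bdd by (auto simp: A_def B_def intro: cSup_upper cInf_lower)
  have AB: "0 < A" "0 < B" using in_range[OF m1(1)] in_range[OF m2(1)] m1 m2 by auto
  have sens_AB: "sensitivity p A B \<le> c"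
  proof -
    have ne: "slopes l \<noteq> {}" using m1 by blast
    obtain f where f: "\<And>n. f n \<in> slopes l" "f \<longlonglongrightarrow> A"
      using closure_contains_Sup[OF ne bdd(1)] unfolding closure_sequential A_def by blast
    obtain g where g: "\<And>n. g n \<in> slopes l" "g \<longlonglongrightarrow> - B"
      using closure_contains_Inf[OF ne bdd(2)] unfolding closure_sequential B_def by auto
    have g': "(\<lambda>n. - g n) \<longlonglongrightarrow> B" using tendsto_minus[OF g(2)] by simp
    have "(\<lambda>n. sensitivity p (f n) (- g n)) \<longlonglongrightarrow> sensitivity p A B"
      unfolding sensitivity_def dual_moment_def
      using AB f(2) g' dual_moment_pos[OF AB, of p]
      by (intro tendsto_intros) (auto simp: dual_moment_def)
    moreover have "\<forall>\<^sub>F n in sequentially. sensitivity p (f n) (- g n) \<le> c"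
      using order_tendstoD(1)[OF f(2) AB(1)] order_tendstoD(1)[OF g' AB(2)]
      by eventually_elim (use f(1) g(1) in \<open>auto intro!: sens\<close>)
    ultimately show ?thesis by (intro tendsto_upperbound) auto
  qed
  have Lip: "l (x + h) \<le> l x + pinball A B h" for x h
  proof -
    obtain m where m: "m \<in> slopes l" "\<And>y. l (x + h) + m * (y - (x + h)) \<le> l y"
      by (rule subgradient_in_slopes[OF l]) (rule that; assumption)
    have "h * m \<le> pinball A B h" by (rule pinball_ge[OF in_range[OF m(1)]])
    then show ?thesis using m(2)[of x] by (simp add: algebra_simps)
  qed
  \<comment> \<open>The two affine minorants make \<open>l\<close> coercive, so it has a minimiser.\<close>
  obtain x0 where x0: "\<And>x. l x0 \<le> l x"
  proof -
    obtain k1 k2 where k: "\<And>x. m1 * x + k1 \<le> l x" "\<And>x. m2 * x + k2 \<le> l x"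
      using m1 m2 unfolding slopes_def by blast
    define R where "R = max \<bar>(l 0 - k1) / m1\<bar> \<bar>(l 0 - k2) / m2\<bar>"
    have R1: "(l 0 - k1) / m1 \<le> R"
      using max.cobounded1 abs_ge_self unfolding R_def by (rule order_trans[rotated])
    have "\<bar>(l 0 - k2) / m2\<bar> \<le> R" unfolding R_def by (rule max.cobounded2)
    then have R2: "- R \<le> (l 0 - k2) / m2" by linarith
    have outside: "l 0 \<le> l x" if "R < \<bar>x\<bar>" for x
    proof (cases "0 \<le> x")
      case True
      then have "(l 0 - k1) / m1 < x" using that R1 by simp
      then show ?thesis using k(1)[of x] m1 by (simp add: pos_divide_less_eq mult.commute)
    next
      case False
      then have "x < (l 0 - k2) / m2" using that R2 by simp
      then show ?thesis using k(2)[of x] m2 by (simp add: neg_less_divide_eq mult.commute)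
    qed
    have R: "0 \<le> R" using R1 R2 \<open>\<bar>(l 0 - k2) / m2\<bar> \<le> R\<close> by linarith
    have "continuous_on {- R..R} l"
      using convex_on_continuous[OF open_UNIV l] by (rule continuous_on_subset) simp
    then obtain y where y: "y \<in> {- R..R}" "\<And>x. x \<in> {- R..R} \<Longrightarrow> l y \<le> l x"
      using continuous_attains_inf[of "{- R..R}" l] R by auto
    have "l y \<le> l x" for x
    proof (cases "R < \<bar>x\<bar>")
      case True
      then show ?thesis using outside[of x] y(2)[of 0] R by simp
    next
      case False
      then have "x \<in> {- R..R}" by auto
      then show ?thesis by (rule y(2))
    qed
    then show ?thesis by (rule that)
  qed
  have l_x0: "l x0 = d"
    using d_approx[of "l x0"] d_le[of x0] x0 by (metis leD order_le_less)
  have "l (x0 + t) = l x0 + pinball A B t" for t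
  proof (rule ccontr)
    assume "l (x0 + t) \<noteq> l x0 + pinball A B t"
    then have "l (x0 + t) < l x0 + pinball A B t" using Lip[of x0 t] by simp
    then obtain \<epsilon> \<delta> where ed: "0 < \<epsilon>" "0 < \<delta>"
      and less: "\<And>G. G \<in> wasserstein_ball p dirac0 \<epsilon> \<Longrightarrow> loss_risk l G \<le> ereal (l x0 + sensitivity p A B * \<epsilon> - \<delta>)"
      using strict_gap_loses_risk[OF p AB lm Lip] by metis
    have "(SUP G\<in>wasserstein_ball p dirac0 \<epsilon>. loss_risk l G)
        \<le> ereal (l x0 + sensitivity p A B * \<epsilon> - \<delta>)"
      using less by (rule SUP_least)
    then have "d + c * \<epsilon> \<le> l x0 + sensitivity p A B * \<epsilon> - \<delta>"
      using eq[of \<epsilon>] ed by (simp add: d)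
    moreover have "sensitivity p A B * \<epsilon> \<le> c * \<epsilon>" using sens_AB ed by simp
    ultimately show False using ed by (simp add: l_x0)
  qed
  then have "l x = pinball A B (x - x0) + d" for x
    by (metis add.commute diff_add_cancel l_x0)
  then show ?thesis using AB by blast
qed

theorem theorem2:
  fixes p :: real and l :: "real \<Rightarrow> real"
  assumes "1 < p"
    and "convex_on UNIV l"
    and "\<forall>G\<in>finite_moment_distributions p. \<bar>loss_risk l G\<bar> \<noteq> \<infinity>"
  shows "(\<exists>c>0. \<forall>G0\<in>finite_moment_distributions p. \<forall>\<epsilon>\<ge>0.
            (SUP G\<in>wasserstein_ball p G0 \<epsilon>. loss_risk l G) = loss_risk l G0 + ereal (c * \<epsilon>))
     \<longleftrightarrow> (\<exists>\<alpha> a b d. 0 < \<alpha> \<and> \<alpha> < 1 \<and> 0 < a \<and> (\<forall>x. l x = a * check_loss \<alpha> (x - b) + d))"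
proof
  assume "\<exists>c>0. \<forall>G0\<in>finite_moment_distributions p. \<forall>\<epsilon>\<ge>0.
            (SUP G\<in>wasserstein_ball p G0 \<epsilon>. loss_risk l G) = loss_risk l G0 + ereal (c * \<epsilon>)"
  then obtain c where "0 < c" "\<And>\<epsilon>. 0 \<le> \<epsilon> \<Longrightarrow>
      (SUP G\<in>wasserstein_ball p dirac0 \<epsilon>. loss_risk l G) = loss_risk l dirac0 + ereal (c * \<epsilon>)"
    using dirac0_finite_moment by blast
  then obtain A B b d where AB: "0 < A" "0 < B" and l: "\<And>x. l x = pinball A B (x - b) + d"
    using pinball_of_linear_growth_at_dirac0[OF assms] by blast
  define \<alpha> where "\<alpha> = A / (A + B)"
  have \<alpha>: "0 < \<alpha>" "\<alpha> < 1" "(A + B) * \<alpha> = A" "(A + B) * (1 - \<alpha>) = B"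
    using AB by (auto simp: \<alpha>_def right_diff_distrib)
  have "l x = (A + B) * check_loss \<alpha> (x - b) + d" for x
    using AB \<alpha> by (simp add: check_loss_eq_pinball l)
  then show "\<exists>\<alpha> a b d. 0 < \<alpha> \<and> \<alpha> < 1 \<and> 0 < a \<and> (\<forall>x. l x = a * check_loss \<alpha> (x - b) + d)"
    using \<alpha> AB add_pos_pos by blast
next
  assume "\<exists>\<alpha> a b d. 0 < \<alpha> \<and> \<alpha> < 1 \<and> 0 < a \<and> (\<forall>x. l x = a * check_loss \<alpha> (x - b) + d)"
  then obtain \<alpha> a b d where \<alpha>: "0 < \<alpha>" "\<alpha> < 1" "0 < a" and "\<And>x. l x = a * check_loss \<alpha> (x - b) + d"
    by blast
  define A B where "A = a * \<alpha>" and "B = a * (1 - \<alpha>)"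
  have AB: "0 < A" "0 < B" using \<alpha> by (auto simp: A_def B_def)
  have l: "l x = pinball A B (x - b) + d" for x
    using \<open>\<And>x. l x = _\<close> check_loss_eq_pinball[OF \<alpha>] by (simp add: A_def B_def)
  note shift = loss_risk_shifted_pinball[OF assms(1) AB _ l]
  show "\<exists>c>0. \<forall>G0\<in>finite_moment_distributions p. \<forall>\<epsilon>\<ge>0.
            (SUP G\<in>wasserstein_ball p G0 \<epsilon>. loss_risk l G) = loss_risk l G0 + ereal (c * \<epsilon>)"
  proof (intro exI[of _ "sensitivity p A B"] conjI ballI allI impI)
    show "0 < sensitivity p A B" by (rule sensitivity_pos[OF AB])
    fix G0 \<epsilon> assume G0: "G0 \<in> finite_moment_distributions p" and \<epsilon>: "0 \<le> (\<epsilon>::real)"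
    \<comment> \<open>The additive constant can be pulled out of the supremum because the ball is not empty.\<close>
    have ne: "wasserstein_ball p G0 \<epsilon> \<noteq> {}"
      using pinball_risk_ball_lower[OF assms(1) AB \<epsilon> G0] by blast
    have "(SUP G\<in>wasserstein_ball p G0 \<epsilon>. loss_risk l G)
        = (SUP G\<in>wasserstein_ball p G0 \<epsilon>. loss_risk (pinball A B) G + ereal d)"
      by (intro SUP_cong refl shift wasserstein_ball_finite_moment[OF assms(1) \<epsilon> G0])
    also have "\<dots> = (SUP G\<in>wasserstein_ball p G0 \<epsilon>. loss_risk (pinball A B) G) + ereal d"
      using ne by (intro SUP_ereal_add_left) auto
    also have "\<dots> = loss_risk l G0 + ereal (sensitivity p A B * \<epsilon>)"
      by (simp add: pinball_risk_ball_SUP[OF assms(1) AB \<epsilon> G0] shift[OF G0] ac_simps)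
    finally show "(SUP G\<in>wasserstein_ball p G0 \<epsilon>. loss_risk l G)
        = loss_risk l G0 + ereal (sensitivity p A B * \<epsilon>)" .
  qed
qed

end
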